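(* Let $\mu,\mu'$ be probability measures on $\mathbb Z$ whose supports have greatest common divisor $1$ each ($\gcd(S_\mu)=\gcd(S_{\mu'})=1$), and let $\xi_1,\xi_1'$ be random variables with laws $\mu,\mu'$. Let $p,q\in\,]0,1[$ with $p+q=1$. Then each of the following conditions is sufficient for the oscillating process $\mathcal X^{(0)}(\mu,\mu')$ to be recurrent on its essential class: (a) $\mathbb E[\xi_1^-]<\mathbb E[\xi_1^+]$, $\mathbb E[(\xi_1^+)^p]<+\infty$, and $\mathbb E[(\xi_1')^+]<\mathbb E[(\xi_1')^-]$, $\mathbb E[((\xi_1')^-)^q]<+\infty$; (b) $\mathbb E[\xi_1^-]=\mathbb E[\xi_1^+]$, $\mathbb E[(\xi_1^+)^{1+p}]<+\infty$, and $\mathbb E[(\xi_1')^+]=\mathbb E[(\xi_1')^-]$, $\mathbb E[((\xi_1')^-)^{1+q}]<+\infty$; (c) $\mathbb E[\xi_1^-]<\mathbb E[\xi_1^+]$, $\mathbb E[(\xi_1^+)^p]<+\infty$, and $\mathbb E[(\xi_1')^+]=\mathbb E[(\xi_1')^-]$, $\mathbb E[((\xi_1')^-)^{1+q}]<+\infty$; (c') $\mathbb E[\xi_1^-]=\mathbb E[\xi_1^+]$, $\mathbb E[(\xi_1^+)^{1+p}]<+\infty$, and $\mathbb E[(\xi_1')^+]<\mathbb E[(\xi_1')^-]$, $\mathbb E[((\xi_1')^-)^{q}]<+\infty$.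
   Context: For a real random variable $Z$, $Z^{\pm}=\max\{\pm Z,0\}$. Expectations of nonnegative variables may be $+\infty$, so a strict inequality such as $\mathbb E[\xi_1^-]<\mathbb E[\xi_1^+]$ means that the left side is finite while the right side is allowed to be $+\infty$. The oscillating random walk $\mathcal X^{(0)}(\mu,\mu')=(X_n^{(0)})_{n\ge0}$ is the Markov chain on $\mathbb Z$ with $X_{n+1}^{(0)}=X_n^{(0)}+\xi_{n+1}$ if $X_n^{(0)}\le-1$ and $X_{n+1}^{(0)}=X_n^{(0)}+\xi'_{n+1}$ if $X_n^{(0)}\ge0$, where $(\xi_n,\xi_n')_{n\ge1}$ is i.i.d., $\xi_n$ has law $\mu$ and $\xi'_n$ has law $\mu'$. An essential class is a closed irreducible (communicating) class; recurrence of the process means recurrence of the state $0$ (which lies in the unique essential class). *)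

theory Defs
  imports "HOL-Probability.Probability"
begin

text \<open>
  The pairs \<open>(\<xi> n, \<xi>' n)\<close>, \<open>n \<ge> 1\<close>, are i.i.d.; the two components of a pair need not be
  independent of each other. Index \<open>0\<close> is not used.
\<close>

definition driving_sequence ::
  "'a measure \<Rightarrow> int pmf \<Rightarrow> int pmf \<Rightarrow> (nat \<Rightarrow> 'a \<Rightarrow> int) \<Rightarrow> (nat \<Rightarrow> 'a \<Rightarrow> int) \<Rightarrow> bool" where
  "driving_sequence M \<mu> \<mu>' \<xi> \<xi>' \<longleftrightarrow>
     prob_space M \<and>
     prob_space.indep_vars M (\<lambda>_. count_space UNIV) (\<lambda>n \<omega>. (\<xi> n \<omega>, \<xi>' n \<omega>)) {1..} \<and>
     (\<forall>n\<ge>1. distr M (count_space UNIV) (\<lambda>\<omega>. (\<xi> n \<omega>, \<xi>' n \<omega>)) =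
             distr M (count_space UNIV) (\<lambda>\<omega>. (\<xi> 1 \<omega>, \<xi>' 1 \<omega>))) \<and>
     (\<forall>n\<ge>1. distr M (count_space UNIV) (\<xi> n) = measure_pmf \<mu>) \<and>
     (\<forall>n\<ge>1. distr M (count_space UNIV) (\<xi>' n) = measure_pmf \<mu>')"

primrec osc_walk ::
  "(nat \<Rightarrow> 'a \<Rightarrow> int) \<Rightarrow> (nat \<Rightarrow> 'a \<Rightarrow> int) \<Rightarrow> int \<Rightarrow> nat \<Rightarrow> 'a \<Rightarrow> int" where
  "osc_walk \<xi> \<xi>' x 0 \<omega> = x"
| "osc_walk \<xi> \<xi>' x (Suc n) \<omega> =
     (if osc_walk \<xi> \<xi>' x n \<omega> \<le> - 1
      then osc_walk \<xi> \<xi>' x n \<omega> + \<xi> (Suc n) \<omega>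
      else osc_walk \<xi> \<xi>' x n \<omega> + \<xi>' (Suc n) \<omega>)"

definition accessible ::
  "'a measure \<Rightarrow> (nat \<Rightarrow> 'a \<Rightarrow> int) \<Rightarrow> (nat \<Rightarrow> 'a \<Rightarrow> int) \<Rightarrow> int \<Rightarrow> int \<Rightarrow> bool" where
  "accessible M \<xi> \<xi>' x y \<longleftrightarrow>
     (\<exists>n. measure M {\<omega> \<in> space M. osc_walk \<xi> \<xi>' x n \<omega> = y} > 0)"

definition essential_class ::
  "'a measure \<Rightarrow> (nat \<Rightarrow> 'a \<Rightarrow> int) \<Rightarrow> (nat \<Rightarrow> 'a \<Rightarrow> int) \<Rightarrow> int set \<Rightarrow> bool" where
  "essential_class M \<xi> \<xi>' C \<longleftrightarrow>
     C \<noteq> {} \<and>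
     (\<forall>x\<in>C. \<forall>y\<in>C. accessible M \<xi> \<xi>' x y) \<and>
     (\<forall>x\<in>C. \<forall>y. accessible M \<xi> \<xi>' x y \<longrightarrow> y \<in> C)"

definition recurrent_state ::
  "'a measure \<Rightarrow> (nat \<Rightarrow> 'a \<Rightarrow> int) \<Rightarrow> (nat \<Rightarrow> 'a \<Rightarrow> int) \<Rightarrow> int \<Rightarrow> bool" where
  "recurrent_state M \<xi> \<xi>' x \<longleftrightarrow> (AE \<omega> in M. \<exists>n\<ge>1. osc_walk \<xi> \<xi>' x n \<omega> = x)"

text \<open>
  Recurrence of the process is recurrence of the state \<open>0\<close>; that \<open>0\<close> lies in the (unique)
  essential class is part of the definition, so that it speaks about that class.
\<close>

definition recurrent_on_essential_class ::
  "'a measure \<Rightarrow> (nat \<Rightarrow> 'a \<Rightarrow> int) \<Rightarrow> (nat \<Rightarrow> 'a \<Rightarrow> int) \<Rightarrow> bool" where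
  "recurrent_on_essential_class M \<xi> \<xi>' \<longleftrightarrow>
     (\<exists>C. essential_class M \<xi> \<xi>' C \<and>
          (\<forall>D. essential_class M \<xi> \<xi>' D \<longrightarrow> D = C) \<and>
          0 \<in> C \<and> recurrent_state M \<xi> \<xi>' 0)"

definition pos_part :: "('a \<Rightarrow> int) \<Rightarrow> 'a \<Rightarrow> real" where
  "pos_part Z \<omega> = max (real_of_int (Z \<omega>)) 0"

definition neg_part :: "('a \<Rightarrow> int) \<Rightarrow> 'a \<Rightarrow> real" where
  "neg_part Z \<omega> = max (- real_of_int (Z \<omega>)) 0"

text \<open>
  Only used for nonnegative \<open>Z\<close>. The value \<open>\<infinity>\<close> is allowed, so
  \<open>nn_expectation M Y < nn_expectation M Z\<close> forces only the left-hand side to be finite.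
\<close>

definition nn_expectation :: "'a measure \<Rightarrow> ('a \<Rightarrow> real) \<Rightarrow> ennreal" where
  "nn_expectation M Z = (\<integral>\<^sup>+\<omega>. ennreal (Z \<omega>) \<partial>M)"

end

theory Submission
  imports Defs "HOL-Number_Theory.Cong"
begin

text \<open>
  Let \<open>K\<close> be the transition kernel and \<open>h\<close> the probability of ever visiting \<open>0\<close>. Then \<open>0 \<le> h \<le> 1 = h 0\<close>
  and \<open>K h \<le> h\<close>, and recurrence says \<open>K h 0 = 1\<close>; so it suffices that superharmonicity is an equality at \<open>0\<close>.
  By optional stopping \<open>h\<close> is also superharmonic for the walk observed at ladder epochs, an oscillating
  walk with one-sided jumps. If \<open>a k\<close> and \<open>b k\<close> are the tails of the ascending ladder height of
  \<open>\<mu>\<close> and of the descending ladder height of \<open>\<mu>'\<close>, the ladder walk has the invariant measure \<open>a y\<close> at \<open>y \<ge> 0\<close>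
  and \<open>b j\<close> at \<open>- 1 - j < 0\<close>. Summing \<open>h - K h \<ge> 0\<close> against it over the window \<open>[- R, R[\<close> leaves a boundary term
  of at most \<open>a R * (\<Sum>k<R. b k) + b R * (\<Sum>k<R. a k)\<close>. The moment conditions give \<open>a k = o(k powr - p)\<close> and
  \<open>b k = o(k powr - q)\<close>, so this term vanishes as \<open>R \<rightarrow> \<infinity>\<close> because \<open>p + q = 1\<close>.
\<close>

section \<open>Ladder heights of a random walk on the integers\<close>

text \<open>The ladder kernel \<open>L\<close> satisfies \<open>L h \<le> K h\<close>, not merely
  \<open>L h \<le> h\<close>: the first step of an excursion is free and only later positions use
  superharmonicity. Hence the defect \<open>h - K h\<close> of the original walk, the quantity that
  decides recurrence, is bounded by the defect of the ladder walk. Until its ladder epoch the walk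
  stays on one half-line, where its steps are homogeneous. The invariant measure may have infinite
  mass, which forces finite windows and a boundary term. Since \<open>p + q = 1\<close>, tails of
  order \<open>O\<close> would only keep that term bounded; the little-o comes from the tail of a
  convergent moment integral. The tail of a ladder height is the step tail summed over the Green
  function of the walk killed on exit. With drift, the total Green mass (the mean ladder epoch) is
  finite, so moment \<open>p\<close> suffices. In the centered case the Green function is only
  bounded pointwise; the step tail is then summed once more over the depth, which costs one further
  moment.\<close>

text \<open>
  For the walk \<open>S\<close> with steps \<open>\<mu>\<close> started at \<open>0\<close>, \<open>stay_below \<mu> n b\<close> is \<open>P(S\<^sub>n = - b, S\<^sub>1, \<dots>, S\<^sub>n \<le> 0)\<close>.
  Read in the variable \<open>b\<close>, the same recursion computes the probability that the walk started
  at \<open>b\<close> is at \<open>0\<close> at time \<open>n\<close> without having been negative; this is the duality of random walks.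
\<close>

primrec stay_below :: "int pmf \<Rightarrow> nat \<Rightarrow> nat \<Rightarrow> ennreal" where
  "stay_below \<mu> 0 b = (if b = 0 then 1 else 0)"
| "stay_below \<mu> (Suc n) b = (\<Sum>j. stay_below \<mu> n j * pmf \<mu> (int j - int b))"

text \<open>In probabilistic terms this is \<open>E[\<phi>(- S\<^sub>n); S\<^sub>1, \<dots>,
  S\<^sub>n \<le> 0]\<close>, with \<open>\<phi>\<close> a function of the depth. For
  \<open>\<phi> = 1\<close> it is the probability that the ladder epoch is later than
  \<open>n\<close>.\<close>

definition below_sum :: "int pmf \<Rightarrow> nat \<Rightarrow> (nat \<Rightarrow> ennreal) \<Rightarrow> ennreal" where
  "below_sum \<mu> n \<phi> = (\<Sum>b. stay_below \<mu> n b * \<phi> b)"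

text \<open>The index is shifted: \<open>ladder \<mu> i\<close> is the probability that the first strict ascending ladder height is \<open>i + 1\<close>.\<close>

definition ladder :: "int pmf \<Rightarrow> nat \<Rightarrow> ennreal" where
  "ladder \<mu> i = (\<Sum>n. below_sum \<mu> n (\<lambda>b. pmf \<mu> (int b + 1 + int i)))"

section \<open>Calculus of the walk killed when it rises above its start\<close>

lemma suminf_swap_ennreal:
  fixes f :: "nat \<Rightarrow> nat \<Rightarrow> ennreal"
  shows "(\<Sum>i. \<Sum>j. f i j) = (\<Sum>j. \<Sum>i. f i j)"
  using nn_integral_suminf[of "\<lambda>i j. f i j" "count_space UNIV"]
  by (simp add: nn_integral_count_space_nat)

lemma below_sum_0 [simp]: "below_sum \<mu> 0 \<phi> = \<phi> 0"
proof -
  have "below_sum \<mu> 0 \<phi> = (\<Sum>b\<in>{0}. stay_below \<mu> 0 b * \<phi> b)"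
    unfolding below_sum_def by (rule suminf_finite) auto
  then show ?thesis by simp
qed

lemma below_sum_mono: "(\<And>b. \<phi> b \<le> \<psi> b) \<Longrightarrow> below_sum \<mu> n \<phi> \<le> below_sum \<mu> n \<psi>"
  unfolding below_sum_def by (intro suminf_le mult_left_mono) auto

lemma below_sum_add:
  "below_sum \<mu> n (\<lambda>b. \<phi> b + \<psi> b) = below_sum \<mu> n \<phi> + below_sum \<mu> n \<psi>"
  unfolding below_sum_def by (simp add: distrib_left suminf_add)

lemma below_sum_cmult: "below_sum \<mu> n (\<lambda>b. c * \<phi> b) = c * below_sum \<mu> n \<phi>"
  unfolding below_sum_def by (simp add: mult.left_commute)

lemma below_sum_const: "below_sum \<mu> n (\<lambda>b. c) = c * below_sum \<mu> n (\<lambda>b. 1)"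
  using below_sum_cmult[of \<mu> n c "\<lambda>_. 1"] by simp

lemma below_sum_zero [simp]: "below_sum \<mu> n (\<lambda>b. 0) = 0"
  unfolding below_sum_def by simp

lemma below_sum_sum:
  "below_sum \<mu> n (\<lambda>b. \<Sum>i\<in>I. \<phi> i b) = (\<Sum>i\<in>I. below_sum \<mu> n (\<phi> i))"
proof (induction I rule: infinite_finite_induct)
  case (insert x F) then show ?case by (simp add: below_sum_add)
qed simp_all

lemma nn_integral_pmf_atMost:
  fixes \<phi> :: "nat \<Rightarrow> ennreal"
  shows "(\<integral>\<^sup>+s. (if s \<le> int b then \<phi> (nat (int b - s)) else 0) \<partial>measure_pmf \<mu>)
    = (\<Sum>c. pmf \<mu> (int b - int c) * \<phi> c)"
proof -
  have "(if s \<le> int b then \<phi> (nat (int b - s)) else 0)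
      = (\<Sum>c. \<phi> c * indicator {int b - int c} s)" for s
  proof (cases "s \<le> int b")
    case True
    have "(\<Sum>c. \<phi> c * indicator {int b - int c} s)
        = (\<Sum>c\<in>{nat (int b - s)}. \<phi> c * indicator {int b - int c} s)"
      by (rule suminf_finite) (use True in \<open>auto simp: indicator_def\<close>)
    then show ?thesis using True by simp
  next
    case False
    then have "\<phi> c * indicator {int b - int c} s = 0" for c by (auto simp: indicator_def)
    then show ?thesis using False by simp
  qed
  then have "(\<integral>\<^sup>+s. (if s \<le> int b then \<phi> (nat (int b - s)) else 0) \<partial>measure_pmf \<mu>)
      = (\<integral>\<^sup>+s. (\<Sum>c. \<phi> c * indicator {int b - int c} s) \<partial>measure_pmf \<mu>)"
    by simp
  also have "\<dots> = (\<Sum>c. \<integral>\<^sup>+s. \<phi> c * indicator {int b - int c} s \<partial>measure_pmf \<mu>)"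
    by (rule nn_integral_suminf) simp
  also have "\<dots> = (\<Sum>c. pmf \<mu> (int b - int c) * \<phi> c)"
    by (simp add: nn_integral_cmult emeasure_pmf_single mult.commute)
  finally show ?thesis .
qed

text \<open>Moves the last step from the killed law to the test function, so that inductions over
  time reduce to a one-step inequality at a fixed depth.\<close>

lemma below_sum_Suc:
  "below_sum \<mu> (Suc n) \<phi>
    = below_sum \<mu> n (\<lambda>b. \<integral>\<^sup>+s. (if s \<le> int b then \<phi> (nat (int b - s)) else 0) \<partial>measure_pmf \<mu>)"
proof -
  have "below_sum \<mu> (Suc n) \<phi> = (\<Sum>c. \<Sum>j. stay_below \<mu> n j * pmf \<mu> (int j - int c) * \<phi> c)"
    by (simp add: below_sum_def)
  also have "\<dots> = (\<Sum>j. \<Sum>c. stay_below \<mu> n j * pmf \<mu> (int j - int c) * \<phi> c)"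
    by (rule suminf_swap_ennreal)
  also have "\<dots> = (\<Sum>j. stay_below \<mu> n j * (\<Sum>c. pmf \<mu> (int j - int c) * \<phi> c))"
    by (simp add: mult.assoc)
  finally show ?thesis by (simp add: below_sum_def nn_integral_pmf_atMost)
qed

lemma nn_integral_pmf_greater_ge:
  fixes \<phi> :: "nat \<Rightarrow> ennreal"
  shows "(\<Sum>i<N. pmf \<mu> (int b + 1 + int i) * \<phi> i)
    \<le> (\<integral>\<^sup>+s. (if int b < s then \<phi> (nat (s - int b - 1)) else 0) \<partial>measure_pmf \<mu>)"
proof -
  have "(\<Sum>i<N. pmf \<mu> (int b + 1 + int i) * \<phi> i)
      = (\<integral>\<^sup>+s. (\<Sum>i<N. \<phi> i * indicator {int b + 1 + int i} s) \<partial>measure_pmf \<mu>)"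
    by (subst nn_integral_sum) (simp_all add: nn_integral_cmult emeasure_pmf_single mult.commute)
  also have "\<dots> \<le> (\<integral>\<^sup>+s. (if int b < s then \<phi> (nat (s - int b - 1)) else 0) \<partial>measure_pmf \<mu>)"
  proof (intro nn_integral_mono)
    fix s
    show "(\<Sum>i<N. \<phi> i * indicator {int b + 1 + int i} s)
        \<le> (if int b < s then \<phi> (nat (s - int b - 1)) else 0)"
    proof (cases "int b < s")
      case True
      have "(\<Sum>i<N. \<phi> i * indicator {int b + 1 + int i} s)
          = (\<Sum>i<N. if i = nat (s - int b - 1) then \<phi> i else 0)"
        using True by (intro sum.cong) (auto simp: indicator_def)
      then show ?thesis using True by simp
    next
      case False
      then show ?thesis by (auto simp: indicator_def)
    qed
  qed
  finally show ?thesis .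
qed

text \<open>Optional stopping at the first time above the start, unrolled step by step. The bound is
  the one-step mean and not \<open>h x\<close>, because superharmonicity is applied only after the
  first step, at positions that are still \<open>\<le> x\<close>.\<close>

lemma ladder_superharmonic:
  fixes h :: "int \<Rightarrow> ennreal"
  assumes super: "\<And>y. y \<le> x \<Longrightarrow> (\<integral>\<^sup>+s. h (y + s) \<partial>measure_pmf \<mu>) \<le> h y"
  shows "(\<Sum>i<N. ladder \<mu> i * h (x + 1 + int i)) \<le> (\<integral>\<^sup>+s. h (x + s) \<partial>measure_pmf \<mu>)"
proof -
  define E where "E b = (\<integral>\<^sup>+s. (if int b < s then h (x + 1 + int (nat (s - int b - 1))) else 0) \<partial>measure_pmf \<mu>)" for b
  define P where "P y = (\<integral>\<^sup>+s. h (y + s) \<partial>measure_pmf \<mu>)" for y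
  have split: "E b + (\<integral>\<^sup>+s. (if s \<le> int b then P (x - int (nat (int b - s))) else 0) \<partial>measure_pmf \<mu>)
      \<le> P (x - int b)" for b
  proof -
    have "E b + (\<integral>\<^sup>+s. (if s \<le> int b then P (x - int (nat (int b - s))) else 0) \<partial>measure_pmf \<mu>)
      = (\<integral>\<^sup>+s. ((if int b < s then h (x + 1 + int (nat (s - int b - 1))) else 0)
             + (if s \<le> int b then P (x - int (nat (int b - s))) else 0)) \<partial>measure_pmf \<mu>)"
      unfolding E_def by (subst nn_integral_add) auto
    also have "\<dots> \<le> P (x - int b)"
      unfolding P_def
    proof (intro nn_integral_mono)
      fix s
      show "(if int b < s then h (x + 1 + int (nat (s - int b - 1))) else 0)
         + (if s \<le> int b then \<integral>\<^sup>+t. h (x - int (nat (int b - s)) + t) \<partial>measure_pmf \<mu> else 0)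
         \<le> h (x - int b + s)"
        using super[of "x - int b + s"] by (auto simp: algebra_simps)
    qed
    finally show ?thesis .
  qed
  \<comment> \<open>Exits up to time \<open>n\<close> are collected at their landing values. The
    surviving part carries \<open>P\<close>, the mean after one more step, so the case
    \<open>n = 0\<close> is an equality.\<close>
  have step: "(\<Sum>m<n. below_sum \<mu> m E) + below_sum \<mu> n (\<lambda>b. P (x - int b)) \<le> P x" for n
  proof (induction n)
    case (Suc n)
    have "(\<Sum>m<Suc n. below_sum \<mu> m E) + below_sum \<mu> (Suc n) (\<lambda>b. P (x - int b))
      = (\<Sum>m<n. below_sum \<mu> m E) + below_sum \<mu> n (\<lambda>b. E b
          + (\<integral>\<^sup>+s. (if s \<le> int b then P (x - int (nat (int b - s))) else 0) \<partial>measure_pmf \<mu>))"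
      by (simp add: below_sum_Suc below_sum_add add.assoc)
    also have "\<dots> \<le> (\<Sum>m<n. below_sum \<mu> m E) + below_sum \<mu> n (\<lambda>b. P (x - int b))"
      by (intro add_left_mono below_sum_mono split)
    finally show ?case using Suc.IH by (rule order_trans)
  qed simp
  have "(\<Sum>i<N. ladder \<mu> i * h (x + 1 + int i))
      = (\<Sum>n. \<Sum>i<N. below_sum \<mu> n (\<lambda>b. pmf \<mu> (int b + 1 + int i) * h (x + 1 + int i)))"
    unfolding ladder_def
    by (subst suminf_sum) (simp_all add: mult.commute below_sum_cmult flip: ennreal_suminf_cmult)
  also have "\<dots> \<le> (\<Sum>n. below_sum \<mu> n E)"
  proof (intro suminf_le)
    fix n
    have "(\<Sum>i<N. below_sum \<mu> n (\<lambda>b. pmf \<mu> (int b + 1 + int i) * h (x + 1 + int i)))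
      = below_sum \<mu> n (\<lambda>b. \<Sum>i<N. pmf \<mu> (int b + 1 + int i) * h (x + 1 + int i))"
      by (rule below_sum_sum[symmetric])
    also have "\<dots> \<le> below_sum \<mu> n E"
      unfolding E_def
      by (intro below_sum_mono nn_integral_pmf_greater_ge[where \<phi> = "\<lambda>i. h (x + 1 + int i)"])
    finally show "(\<Sum>i<N. below_sum \<mu> n (\<lambda>b. pmf \<mu> (int b + 1 + int i) * h (x + 1 + int i)))
        \<le> below_sum \<mu> n E" .
  qed auto
  also have "\<dots> \<le> P x"
    unfolding suminf_eq_SUP
  proof (rule SUP_least)
    fix n show "(\<Sum>m<n. below_sum \<mu> m E) \<le> P x"
      using step[of n] by (rule order_trans[rotated]) simp
  qed
  finally show ?thesis unfolding P_def .
qed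

lemma sum_ladder_le_1: "(\<Sum>i<N. ladder \<mu> i) \<le> 1"
  using ladder_superharmonic[where x = 0 and h = "\<lambda>_. 1" and \<mu> = \<mu> and N = N] by (simp add: measure_pmf.emeasure_space_1[simplified])

lemma ladder_finite: "ladder \<mu> i < \<infinity>"
proof -
  have "ladder \<mu> i \<le> (\<Sum>j<Suc i. ladder \<mu> j)" by simp
  also have "\<dots> \<le> 1" by (rule sum_ladder_le_1)
  finally show ?thesis by (auto intro: le_less_trans)
qed

section \<open>Exit from the half-line: overshoot, mean exit time, Green function\<close>

lemma below_sum_conservation:
  "(\<Sum>m<n. below_sum \<mu> m (\<lambda>b. emeasure \<mu> {int b<..})) + below_sum \<mu> n (\<lambda>b. 1) = 1"
proof (induction n)
  case (Suc n)
  have *: "emeasure \<mu> {int b<..} + (\<integral>\<^sup>+s. (if s \<le> int b then 1 else 0) \<partial>measure_pmf \<mu>) = 1" for b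
  proof -
    have "(\<integral>\<^sup>+s. (if s \<le> int b then 1 else 0) \<partial>measure_pmf \<mu>)
        = (\<integral>\<^sup>+s. indicator {..int b} s \<partial>measure_pmf \<mu>)"
      by (intro nn_integral_cong) (auto simp: indicator_def)
    then have "(\<integral>\<^sup>+s. (if s \<le> int b then 1 else 0) \<partial>measure_pmf \<mu>) = emeasure \<mu> {..int b}"
      by simp
    moreover have "emeasure \<mu> {int b<..} + emeasure \<mu> {..int b} = emeasure \<mu> ({int b<..} \<union> {..int b})"
      by (rule plus_emeasure) auto
    moreover have "{int b<..} \<union> {..int b} = UNIV" by auto
    ultimately show ?thesis by (simp add: measure_pmf.emeasure_space_1[simplified])
  qed
  have "(\<Sum>m<Suc n. below_sum \<mu> m (\<lambda>b. emeasure \<mu> {int b<..})) + below_sum \<mu> (Suc n) (\<lambda>b. 1)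
    = (\<Sum>m<n. below_sum \<mu> m (\<lambda>b. emeasure \<mu> {int b<..}))
      + below_sum \<mu> n (\<lambda>b. emeasure \<mu> {int b<..} + (\<integral>\<^sup>+s. (if s \<le> int b then 1 else 0) \<partial>measure_pmf \<mu>))"
    by (simp add: below_sum_Suc below_sum_add add.assoc)
  then show ?case using Suc.IH unfolding * by simp
qed simp

lemma below_sum_one_le_1: "below_sum \<mu> n (\<lambda>b. 1) \<le> 1"
  using below_sum_conservation[of \<mu> n] by (metis add.commute le_iff_add)

lemma decseq_below_sum_one: "decseq (\<lambda>n. below_sum \<mu> n (\<lambda>b. 1))"
proof (rule decseq_SucI)
  fix n
  have "below_sum \<mu> (Suc n) (\<lambda>b. 1)
    = below_sum \<mu> n (\<lambda>b. \<integral>\<^sup>+s. (if s \<le> int b then 1 else 0) \<partial>measure_pmf \<mu>)"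
    by (rule below_sum_Suc)
  also have "\<dots> \<le> below_sum \<mu> n (\<lambda>b. \<integral>\<^sup>+s. 1 \<partial>measure_pmf \<mu>)"
    by (intro below_sum_mono nn_integral_mono) auto
  finally show "below_sum \<mu> (Suc n) (\<lambda>b. 1) \<le> below_sum \<mu> n (\<lambda>b. 1)"
    by (simp add: measure_pmf.emeasure_space_1[simplified])
qed

text \<open>Almost sure exit turns the conservation of mass into a statement about exits alone.
  Splitting the exiting step at \<open>k\<close> units above the start leaves the ladder heights up
  to \<open>k\<close> and a series over long steps, which therefore dominates the tail of the ladder
  height.\<close>

lemma ladder_tail:
  assumes "(\<lambda>n. below_sum \<mu> n (\<lambda>b. 1)) \<longlonglongrightarrow> 0"
  shows "1 \<le> (\<Sum>i<k. ladder \<mu> i) + (\<Sum>n. below_sum \<mu> n (\<lambda>b. emeasure \<mu> {int b + int k<..}))"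
proof -
  have split: "emeasure \<mu> {int b<..} = (\<Sum>i<k. ennreal (pmf \<mu> (int b + 1 + int i))) + emeasure \<mu> {int b + int k<..}" for b
  proof -
    have "{int b<..} = (\<lambda>i. int b + 1 + int i) ` {..<k} \<union> {int b + int k<..}"
    proof (rule set_eqI)
      fix x :: int
      show "x \<in> {int b<..} \<longleftrightarrow> x \<in> (\<lambda>i. int b + 1 + int i) ` {..<k} \<union> {int b + int k<..}"
        by (cases "int b < x \<and> x \<le> int b + int k")
          (auto intro!: image_eqI[of _ _ "nat (x - int b - 1)"])
    qed
    then have "emeasure \<mu> {int b<..} = emeasure \<mu> ((\<lambda>i. int b + 1 + int i) ` {..<k}) + emeasure \<mu> {int b + int k<..}"
      by (subst plus_emeasure) auto
    also have "emeasure \<mu> ((\<lambda>i. int b + 1 + int i) ` {..<k}) = (\<Sum>i<k. ennreal (pmf \<mu> (int b + 1 + int i)))"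
      by (subst emeasure_measure_pmf_finite) (auto simp: sum.reindex inj_on_def)
    finally show ?thesis .
  qed
  let ?T = "\<Sum>n. below_sum \<mu> n (\<lambda>b. emeasure \<mu> {int b + int k<..})"
  have le: "1 \<le> (\<Sum>i<k. ladder \<mu> i) + ?T + below_sum \<mu> n (\<lambda>b. 1)" for n
  proof -
    have "(\<Sum>m<n. below_sum \<mu> m (\<lambda>b. emeasure \<mu> {int b<..}))
      \<le> (\<Sum>m. below_sum \<mu> m (\<lambda>b. emeasure \<mu> {int b<..}))"
      by (rule sum_le_suminf) auto
    also have "\<dots> = (\<Sum>i<k. ladder \<mu> i) + ?T"
      unfolding split below_sum_add below_sum_sum ladder_def
      by (subst suminf_add[symmetric]) (auto simp: suminf_sum)
    finally show ?thesis
      by (subst below_sum_conservation[symmetric, where n = n and \<mu> = \<mu>]) (rule add_right_mono)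
  qed
  have "(\<lambda>n. (\<Sum>i<k. ladder \<mu> i) + ?T + below_sum \<mu> n (\<lambda>b. 1)) \<longlonglongrightarrow> (\<Sum>i<k. ladder \<mu> i) + ?T + 0"
    by (intro tendsto_intros assms)
  then show ?thesis using le by (simp add: LIMSEQ_le_const)
qed

text \<open>Foster's argument with the Lyapunov function \<open>L + b\<close> for the surviving walk
  and \<open>0\<close> after exit. The offset \<open>L\<close> pays for the decrease at exit; the
  series is the mean ladder epoch.\<close>

lemma below_sum_drift:
  fixes L m :: ennreal
  assumes drift: "\<And>b::nat. (\<integral>\<^sup>+s. (if s \<le> int b then L + of_nat (nat (int b - s)) else 0) \<partial>measure_pmf \<mu>) + m \<le> L + of_nat b"
  shows "m * (\<Sum>n. below_sum \<mu> n (\<lambda>b. 1)) \<le> L"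
proof -
  have step: "(\<Sum>i<n. m * below_sum \<mu> i (\<lambda>b. 1)) + below_sum \<mu> n (\<lambda>b. L + of_nat b) \<le> L" for n
  proof (induction n)
    case (Suc n)
    have "(\<Sum>i<Suc n. m * below_sum \<mu> i (\<lambda>b. 1)) + below_sum \<mu> (Suc n) (\<lambda>b. L + of_nat b)
      = (\<Sum>i<n. m * below_sum \<mu> i (\<lambda>b. 1)) + below_sum \<mu> n (\<lambda>b.
         (\<integral>\<^sup>+s. (if s \<le> int b then L + of_nat (nat (int b - s)) else 0) \<partial>measure_pmf \<mu>) + m)"
      unfolding below_sum_Suc[where \<phi> = "\<lambda>b. L + of_nat b"] below_sum_add[where \<psi> = "\<lambda>b. m"]
        below_sum_const[where c = m]
      by (simp only: sum.lessThan_Suc ac_simps)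
    also have "\<dots> \<le> (\<Sum>i<n. m * below_sum \<mu> i (\<lambda>b. 1)) + below_sum \<mu> n (\<lambda>b. L + of_nat b)"
      by (intro add_left_mono below_sum_mono drift)
    finally show ?case using Suc.IH by (rule order_trans)
  qed simp
  have "m * (\<Sum>n. below_sum \<mu> n (\<lambda>b. 1)) = (\<Sum>n. m * below_sum \<mu> n (\<lambda>b. 1))"
    by simp
  also have "\<dots> \<le> L"
    unfolding suminf_eq_SUP
  proof (rule SUP_least)
    fix n show "(\<Sum>i<n. m * below_sum \<mu> i (\<lambda>b. 1)) \<le> L"
      using step[of n] by (rule order_trans[rotated]) simp
  qed
  finally show ?thesis .
qed

text \<open>By duality the left-hand side solves \<open>\<gamma> = \<delta>\<^sub>0 + P \<gamma>\<close> on the half-line, of which the constant \<open>c\<close> is a supersolution.\<close>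

lemma stay_below_green_bound:
  fixes \<mu> :: "int pmf"
  assumes c: "1 + c * emeasure \<mu> {0..} \<le> c"
  shows "(\<Sum>n<N. stay_below \<mu> n b) \<le> c"
proof (induction N arbitrary: b)
  case (Suc N)
  have mass: "(\<Sum>j. ennreal (pmf \<mu> (int j - int b))) = emeasure \<mu> {- int b..}"
  proof -
    have "emeasure \<mu> {- int b..} = (\<integral>\<^sup>+s. (\<Sum>j. indicator {int j - int b} s) \<partial>measure_pmf \<mu>)"
    proof -
      have "(\<Sum>j. indicator {int j - int b} s :: ennreal) = indicator {- int b..} s" for s
      proof (cases "- int b \<le> s")
        case True
        have "(\<Sum>j. indicator {int j - int b} s :: ennreal) = (\<Sum>j\<in>{nat (s + int b)}. indicator {int j - int b} s)"
          by (rule suminf_finite) (use True in \<open>auto simp: indicator_def\<close>)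
        then show ?thesis using True by simp
      next
        case False
        then have "indicator {int j - int b} s = (0::ennreal)" for j by (auto simp: indicator_def)
        then show ?thesis using False by simp
      qed
      then show ?thesis by simp
    qed
    also have "\<dots> = (\<Sum>j. \<integral>\<^sup>+s. indicator {int j - int b} s \<partial>measure_pmf \<mu>)"
      by (rule nn_integral_suminf) simp
    finally show ?thesis by (simp add: emeasure_pmf_single)
  qed
  have "(\<Sum>n<Suc N. stay_below \<mu> n b) = (if b = 0 then 1 else 0) + (\<Sum>n<N. stay_below \<mu> (Suc n) b)"
    by (subst sum.lessThan_Suc_shift) simp
  also have "(\<Sum>n<N. stay_below \<mu> (Suc n) b) = (\<Sum>j. \<Sum>n<N. stay_below \<mu> n j * pmf \<mu> (int j - int b))"
    by (simp add: suminf_sum)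
  also have "\<dots> = (\<Sum>j. (\<Sum>n<N. stay_below \<mu> n j) * pmf \<mu> (int j - int b))"
    by (simp add: sum_distrib_right)
  also have "\<dots> \<le> (\<Sum>j. c * pmf \<mu> (int j - int b))"
    by (intro suminf_le mult_right_mono Suc.IH) auto
  also have "\<dots> = c * emeasure \<mu> {- int b..}"
    by (simp add: mass)
  \<comment> \<open>The source term sits only at \<open>b = 0\<close>, where the incoming mass is
    that of \<open>{0..}\<close> and the hypothesis on \<open>c\<close> leaves room for it. At other
    depths mass at most \<open>1\<close> is enough.\<close>
  also have "(if b = 0 then 1 else 0) + c * emeasure \<mu> {- int b..} \<le> c"
  proof (cases "b = 0")
    case False
    have "c * emeasure \<mu> {- int b..} \<le> c * 1"
      by (intro mult_left_mono measure_pmf.emeasure_le_1) simp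
    then show ?thesis using False by simp
  qed (use c in simp)
  finally show ?case by (simp add: add_left_mono)
qed simp

lemma decseq_ennreal_LIMSEQ_0I:
  fixes f :: "nat \<Rightarrow> ennreal"
  assumes "decseq f" and "\<And>\<alpha>. 0 < \<alpha> \<Longrightarrow> (\<And>n. ennreal \<alpha> \<le> f n) \<Longrightarrow> False"
  shows "f \<longlonglongrightarrow> 0"
proof -
  have lim: "f \<longlonglongrightarrow> (INF n. f n)" using assms(1) by (rule LIMSEQ_INF)
  moreover have "(INF n. f n) = 0"
  proof (rule ccontr)
    assume "(INF n. f n) \<noteq> 0"
    then have "0 < (INF n. f n)" by (simp add: zero_less_iff_neq_zero)
    then obtain y where y: "0 < y" "y < (INF n. f n)" using dense by blast
    then obtain \<alpha> where \<alpha>: "y = ennreal \<alpha>" "0 \<le> \<alpha>" by (cases y) auto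
    have "ennreal \<alpha> \<le> f n" for n
      using y(2) INF_lower[of n UNIV f] \<alpha>(1) by (meson UNIV_I less_imp_le less_le_trans)
    then show False using assms(2)[of \<alpha>] y \<alpha> by simp
  qed
  ultimately show ?thesis by simp
qed

text \<open>
  If the walk stayed below \<open>0\<close> forever with probability \<open>\<alpha> > 0\<close>, the bounded Green function would force its depth
  up to time \<open>N\<close> to be of order \<open>\<alpha> * N\<close>, whereas centering makes the mean depth grow only by \<open>e\<close> of the current
  depth per step, hence sublinearly.
\<close>

lemma below_sum_centered_tendsto_0:
  fixes e :: "nat \<Rightarrow> ennreal"
  assumes green: "\<And>N b. (\<Sum>n<N. stay_below \<mu> n b) \<le> ennreal c" and "0 < c"
    and centered: "\<And>b::nat. (\<integral>\<^sup>+s. (if s \<le> int b then of_nat (nat (int b - s)) else 0) \<partial>measure_pmf \<mu>) = of_nat b + e b"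
    and e: "decseq e" "e \<longlonglongrightarrow> 0" "e 0 < \<infinity>"
  shows "(\<lambda>n. below_sum \<mu> n (\<lambda>b. 1)) \<longlonglongrightarrow> 0"
proof (rule decseq_ennreal_LIMSEQ_0I[OF decseq_below_sum_one])
  fix \<alpha> :: real assume \<alpha>: "0 < \<alpha>" "\<And>n. ennreal \<alpha> \<le> below_sum \<mu> n (\<lambda>b. 1)"
  define M where "M n = below_sum \<mu> n of_nat" for n
  have M_Suc: "M (Suc n) = M n + below_sum \<mu> n e" for n
    unfolding M_def below_sum_Suc centered by (rule below_sum_add)
  have M_0: "M 0 = 0" by (simp add: M_def)
  have M_eq: "M N = (\<Sum>n<N. below_sum \<mu> n e)" for N
    by (induction N) (simp_all add: M_0 M_Suc)
  have M_mono: "M n \<le> M N" if "n \<le> N" for n N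
    using that by (rule lift_Suc_mono_le[rotated]) (simp add: M_Suc)
  have sum_swap: "(\<Sum>n<N. below_sum \<mu> n \<phi>) = (\<Sum>b. (\<Sum>n<N. stay_below \<mu> n b) * \<phi> b)" for N \<phi>
    unfolding below_sum_def by (subst suminf_sum[symmetric]) (simp_all add: sum_distrib_right)
  have total: "(\<Sum>b. (\<Sum>n<N. stay_below \<mu> n b)) \<le> of_nat N" for N
  proof -
    have "(\<Sum>b. (\<Sum>n<N. stay_below \<mu> n b)) = (\<Sum>n<N. below_sum \<mu> n (\<lambda>b. 1))"
      by (simp add: sum_swap)
    also have "\<dots> \<le> (\<Sum>n<N. 1)" by (intro sum_mono below_sum_one_le_1)
    finally show ?thesis by simp
  qed
  have e_fin: "e b < \<infinity>" for b
    using e(3) decseqD[OF e(1), of 0 b] by (auto intro: le_less_trans)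
  have window: "(\<Sum>b<B. (\<Sum>n<N. stay_below \<mu> n b) * \<phi> b) \<le> (\<Sum>b<B. ennreal c * \<phi> b)" for N B \<phi>
    by (intro sum_mono mult_right_mono green) simp
  \<comment> \<open>Depths less than \<open>B\<close> are charged to the Green bound, greater ones
    to \<open>e B\<close> and the total time \<open>N\<close>.\<close>
  have upper: "M N \<le> of_nat B * (ennreal c * e 0) + of_nat N * e B" for N B
  proof -
    have "M N = (\<Sum>b. (\<Sum>n<N. stay_below \<mu> n b) * e b)" unfolding M_eq sum_swap ..
    also have "\<dots> = (\<Sum>b<B. (\<Sum>n<N. stay_below \<mu> n b) * e b) + (\<Sum>b. (\<Sum>n<N. stay_below \<mu> n (b + B)) * e (b + B))"
      by (subst suminf_offset[of _ B]) (simp_all add: add.commute)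
    also have "(\<Sum>b<B. (\<Sum>n<N. stay_below \<mu> n b) * e b) \<le> (\<Sum>b<B. ennreal c * e 0)"
      by (intro sum_mono mult_mono green decseqD[OF e(1)]) auto
    also have "(\<Sum>b. (\<Sum>n<N. stay_below \<mu> n (b + B)) * e (b + B)) \<le> (\<Sum>b. (\<Sum>n<N. stay_below \<mu> n (b + B)) * e B)"
      by (intro suminf_le mult_left_mono decseqD[OF e(1)]) auto
    also have "\<dots> = (\<Sum>b. (\<Sum>n<N. stay_below \<mu> n (b + B))) * e B" by simp
    also have "\<dots> \<le> of_nat N * e B"
    proof (rule mult_right_mono)
      have "(\<Sum>b. (\<Sum>n<N. stay_below \<mu> n (b + B))) \<le> (\<Sum>b. (\<Sum>n<N. stay_below \<mu> n b))"
        by (subst suminf_offset[of "\<lambda>b. \<Sum>n<N. stay_below \<mu> n b" B]) simp_all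
      then show "(\<Sum>b. (\<Sum>n<N. stay_below \<mu> n (b + B))) \<le> of_nat N" using total by (rule order_trans)
    qed simp
    finally show ?thesis by (simp add: add_mono)
  qed
  \<comment> \<open>At most \<open>B * c\<close> of the expected surviving time is spent at depths
    less than \<open>B\<close>; during the rest the depth is at least \<open>B\<close>, which feeds
    the mean depth.\<close>
  have lower: "of_nat N * of_nat B * ennreal \<alpha> \<le> of_nat N * M N + of_nat B * (of_nat B * ennreal c)" for N B
  proof -
    have "of_nat N * ennreal \<alpha> = (\<Sum>n<N. ennreal \<alpha>)" by simp
    also have "\<dots> \<le> (\<Sum>n<N. below_sum \<mu> n (\<lambda>b. 1))" by (intro sum_mono \<alpha>)
    finally have "of_nat N * ennreal \<alpha> \<le> (\<Sum>n<N. below_sum \<mu> n (\<lambda>b. 1))" .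
    then have "of_nat B * (of_nat N * ennreal \<alpha>) \<le> of_nat B * (\<Sum>n<N. below_sum \<mu> n (\<lambda>b. 1))"
      by (rule mult_left_mono) simp
    also have "\<dots> = (\<Sum>b. (\<Sum>n<N. stay_below \<mu> n b) * of_nat B)"
      unfolding sum_swap by (simp add: mult.commute)
    also have "\<dots> = (\<Sum>b<B. (\<Sum>n<N. stay_below \<mu> n b) * of_nat B) + (\<Sum>b. (\<Sum>n<N. stay_below \<mu> n (b + B)) * of_nat B)"
      by (subst suminf_offset[of _ B]) (simp_all add: add.commute)
    also have "(\<Sum>b<B. (\<Sum>n<N. stay_below \<mu> n b) * of_nat B) \<le> (\<Sum>b<B. ennreal c * of_nat B)"
      by (rule window)
    also have "(\<Sum>b<B. ennreal c * of_nat B) = of_nat B * (of_nat B * ennreal c)" by (simp add: ac_simps)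
    also have "(\<Sum>b. (\<Sum>n<N. stay_below \<mu> n (b + B)) * of_nat B) \<le> (\<Sum>b. (\<Sum>n<N. stay_below \<mu> n (b + B)) * of_nat (b + B))"
      by (intro suminf_le mult_left_mono) auto
    also have "\<dots> \<le> (\<Sum>b. (\<Sum>n<N. stay_below \<mu> n b) * of_nat b)"
      by (subst suminf_offset[of "\<lambda>b. (\<Sum>n<N. stay_below \<mu> n b) * of_nat b" B]) simp_all
    also have "\<dots> = (\<Sum>n<N. M n)" unfolding M_def by (simp add: sum_swap)
    also have "\<dots> \<le> (\<Sum>n<N. M N)" by (intro sum_mono M_mono) simp
    finally show ?thesis by (simp add: ac_simps add_mono)
  qed
  have both: "real N * real B * \<alpha> \<le> real N * (real D * (c * enn2real (e 0)) + real N * enn2real (e D)) + real B * (real B * c)"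
    for N B D
  proof -
    have "ennreal (real N * real B * \<alpha>) = of_nat N * of_nat B * ennreal \<alpha>"
      using \<alpha> by (simp add: ennreal_mult ennreal_of_nat_eq_real_of_nat)
    also have "\<dots> \<le> of_nat N * (of_nat D * (ennreal c * e 0) + of_nat N * e D) + of_nat B * (of_nat B * ennreal c)"
      by (rule order_trans[OF lower add_right_mono[OF mult_left_mono[OF upper]]]) simp
    also have "\<dots> = ennreal (real N * (real D * (c * enn2real (e 0)) + real N * enn2real (e D)) + real B * (real B * c))"
      using \<open>0 < c\<close> e_fin[of 0] e_fin[of D]
      by (simp add: ennreal_mult ennreal_of_nat_eq_real_of_nat)
    finally show ?thesis using \<open>0 < c\<close> by (subst (asm) ennreal_le_iff) auto
  qed
  have e_real: "(\<lambda>D. enn2real (e D)) \<longlonglongrightarrow> 0"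
    using tendsto_enn2real[of e 0] e(2) by simp
  \<comment> \<open>The choice of \<open>B\<close> below gains
    \<open>N\<^sup>2 * \<alpha>\<^sup>2 / (4 * c)\<close>; this bound on \<open>e D\<close> gives
    back only a quarter of it.\<close>
  obtain D where D: "enn2real (e D) < \<alpha>\<^sup>2 / (16 * c)"
    using order_tendstoD(2)[OF e_real, of "\<alpha>\<^sup>2 / (16 * c)"] \<alpha> \<open>0 < c\<close>
    by (auto simp: eventually_sequentially)
  define K where "K = real D * (c * enn2real (e 0))"
  have ineq: "real N * real B * \<alpha> \<le> real N * K + (real N)\<^sup>2 * (\<alpha>\<^sup>2 / (16 * c)) + (real B)\<^sup>2 * c" for N B
  proof -
    have "real N * real B * \<alpha> \<le> real N * K + (real N)\<^sup>2 * enn2real (e D) + (real B)\<^sup>2 * c"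
      using both[of N B D] by (simp add: K_def power2_eq_square algebra_simps)
    also have "\<dots> \<le> real N * K + (real N)\<^sup>2 * (\<alpha>\<^sup>2 / (16 * c)) + (real B)\<^sup>2 * c"
      using D by (intro add_mono mult_left_mono) auto
    finally show ?thesis .
  qed
  \<comment> \<open>Up to rounding, the maximiser of
    \<open>N * B * \<alpha> - B\<^sup>2 * c\<close>. Rounding down costs at most
    \<open>N * \<alpha>\<close>, which accounts for the summand \<open>\<alpha>\<close> next to
    \<open>K\<close> in \<open>final\<close>.\<close>
  define B where "B N = nat \<lfloor>real N * \<alpha> / (2 * c)\<rfloor>" for N
  have B_le: "real (B N) \<le> real N * \<alpha> / (2 * c)" and B_ge: "real N * \<alpha> / (2 * c) - 1 \<le> real (B N)" for N
    using \<alpha> \<open>0 < c\<close> unfolding B_def by auto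
  have final: "(real N)\<^sup>2 * (3 * \<alpha>\<^sup>2 / (16 * c)) \<le> real N * (K + \<alpha>)" for N
  proof -
    define u where "u = real N * \<alpha> / (2 * c)"
    have u: "real N * \<alpha> = 2 * c * u" using \<open>0 < c\<close> by (simp add: u_def)
    have "real N * \<alpha> * (u - 1) \<le> real N * \<alpha> * real (B N)"
      using B_ge[of N] \<alpha> by (intro mult_left_mono) (auto simp: u_def)
    moreover have "(real (B N))\<^sup>2 * c \<le> u\<^sup>2 * c"
      using B_le[of N] \<open>0 < c\<close> by (intro mult_right_mono power_mono) (auto simp: u_def)
    ultimately have "real N * \<alpha> * (u - 1) \<le> real N * K + (real N)\<^sup>2 * (\<alpha>\<^sup>2 / (16 * c)) + u\<^sup>2 * c"
      using ineq[of N "B N"] by (simp add: algebra_simps)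
    moreover have "u\<^sup>2 * c = (real N)\<^sup>2 * (\<alpha>\<^sup>2 / (4 * c))" "real N * \<alpha> * u = (real N)\<^sup>2 * (\<alpha>\<^sup>2 / (2 * c))"
      using \<open>0 < c\<close> by (simp_all add: u_def power2_eq_square field_simps)
    ultimately show ?thesis using \<open>0 < c\<close> by (simp add: field_simps)
  qed
  define \<kappa> where "\<kappa> = 3 * \<alpha>\<^sup>2 / (16 * c)"
  have "0 < \<kappa>" using \<alpha> \<open>0 < c\<close> by (simp add: \<kappa>_def)
  obtain N :: nat where N: "(K + \<alpha>) / \<kappa> < real N" "0 < N"
    by (metis reals_Archimedean2 max_less_iff_conj of_nat_0_less_iff)
  have "real N * (real N * \<kappa>) \<le> real N * (K + \<alpha>)"
    using final[of N] by (simp add: \<kappa>_def power2_eq_square mult.assoc)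
  then have "real N * \<kappa> \<le> K + \<alpha>" using N by simp
  then show False using N \<open>0 < \<kappa>\<close> by (simp add: field_simps)
qed

section \<open>Moment conditions and decay of ladder-height tails\<close>

lemma nn_integral_pmf_tail_tendsto_0:
  fixes w :: "int \<Rightarrow> ennreal"
  assumes "(\<integral>\<^sup>+s. w s \<partial>measure_pmf \<mu>) < \<infinity>"
  shows "(\<lambda>k. \<integral>\<^sup>+s. w s * indicator {int k<..} s \<partial>measure_pmf \<mu>) \<longlonglongrightarrow> 0"
proof -
  have "(\<lambda>k. \<integral>\<^sup>+s. w s * indicator {int k<..} s \<partial>measure_pmf \<mu>) \<longlonglongrightarrow> (\<integral>\<^sup>+s. 0 \<partial>measure_pmf \<mu>)"
  proof (rule nn_integral_dominated_convergence[where w = w])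
    show "AE s in measure_pmf \<mu>. (\<lambda>k. w s * indicator {int k<..} s) \<longlonglongrightarrow> 0"
    proof (intro AE_I2)
      fix s
      have "eventually (\<lambda>k. w s * indicator {int k<..} s = 0) sequentially"
        using eventually_ge_at_top[of "nat s"] by eventually_elim (auto simp: indicator_def)
      then show "(\<lambda>k. w s * indicator {int k<..} s) \<longlonglongrightarrow> 0" by (rule tendsto_eventually)
    qed
  qed (use assms in \<open>auto simp: indicator_def\<close>)
  then show ?thesis by simp
qed

text \<open>The share of one half-line in the hypotheses. The four sufficient conditions are exactly
  the combinations of its two alternatives for \<open>\<mu>\<close> with those for the reflection of
  \<open>\<mu>'\<close>.\<close>

definition upward :: "real \<Rightarrow> int pmf \<Rightarrow> bool" where
  "upward p \<mu> \<longleftrightarrow>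
     ((\<integral>\<^sup>+s. ennreal (max (- real_of_int s) 0) \<partial>measure_pmf \<mu>) < (\<integral>\<^sup>+s. ennreal (max (real_of_int s) 0) \<partial>measure_pmf \<mu>) \<and>
      (\<integral>\<^sup>+s. ennreal (max (real_of_int s) 0 powr p) \<partial>measure_pmf \<mu>) < \<infinity>) \<or>
     ((\<integral>\<^sup>+s. ennreal (max (- real_of_int s) 0) \<partial>measure_pmf \<mu>) = (\<integral>\<^sup>+s. ennreal (max (real_of_int s) 0) \<partial>measure_pmf \<mu>) \<and>
      (\<integral>\<^sup>+s. ennreal (max (real_of_int s) 0 powr (1 + p)) \<partial>measure_pmf \<mu>) < \<infinity>)"

lemma nn_integral_pos_part_eq_0_iff:
  "(\<integral>\<^sup>+s. ennreal (max (real_of_int s) 0) \<partial>measure_pmf \<mu>) = 0 \<longleftrightarrow> (\<forall>s\<in>set_pmf \<mu>. s \<le> 0)"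
  by (subst nn_integral_0_iff_AE) (auto simp: AE_measure_pmf_iff ennreal_eq_0_iff max_def)

lemma nn_integral_neg_part_eq_0_iff:
  "(\<integral>\<^sup>+s. ennreal (max (- real_of_int s) 0) \<partial>measure_pmf \<mu>) = 0 \<longleftrightarrow> (\<forall>s\<in>set_pmf \<mu>. 0 \<le> s)"
  by (subst nn_integral_0_iff_AE) (auto simp: AE_measure_pmf_iff ennreal_eq_0_iff max_def)

text \<open>Without positive steps the drift alternative fails, and centering leaves only the point
  mass at \<open>0\<close>, whose support has gcd \<open>0\<close>.\<close>

lemma upward_positive_step:
  assumes "upward p \<mu>" and "Gcd (set_pmf \<mu>) = 1"
  obtains s where "s \<in> set_pmf \<mu>" "0 < s"
proof (rule ccontr)
  assume "\<not> thesis"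
  then have nonpos: "\<forall>s\<in>set_pmf \<mu>. s \<le> 0" using that not_less by blast
  then have "(\<integral>\<^sup>+s. ennreal (max (real_of_int s) 0) \<partial>measure_pmf \<mu>) = 0"
    using nn_integral_pos_part_eq_0_iff[of \<mu>] by blast
  then have "(\<integral>\<^sup>+s. ennreal (max (- real_of_int s) 0) \<partial>measure_pmf \<mu>) = 0"
    using assms(1) by (auto simp: upward_def)
  then have "\<forall>s\<in>set_pmf \<mu>. 0 \<le> s" using nn_integral_neg_part_eq_0_iff[of \<mu>] by blast
  with nonpos have "set_pmf \<mu> \<subseteq> {0}" by force
  then have "Gcd (set_pmf \<mu>) = 0" by simp
  then show False using assms(2) by simp
qed

text \<open>Drift makes the mean ladder epoch finite. From any depth, landing more than
  \<open>k\<close> above the start takes a step longer than \<open>k\<close>, so the overshoot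
  series is at most the mean epoch times the step tail, and Markov's inequality restricted to
  \<open>{k<..}\<close> finishes.\<close>

lemma drift_tail:
  assumes lt: "(\<integral>\<^sup>+s. ennreal (max (- real_of_int s) 0) \<partial>measure_pmf \<mu>) < (\<integral>\<^sup>+s. ennreal (max (real_of_int s) 0) \<partial>measure_pmf \<mu>)"
    and "0 < p"
  shows "(\<lambda>n. below_sum \<mu> n (\<lambda>b. 1)) \<longlonglongrightarrow> 0"
    and "\<exists>C<\<infinity>. \<forall>k. ennreal (real k powr p) * (\<Sum>n. below_sum \<mu> n (\<lambda>b. emeasure \<mu> {int b + int k<..}))
      \<le> C * (\<integral>\<^sup>+s. ennreal (max (real_of_int s) 0 powr p) * indicator {int k<..} s \<partial>measure_pmf \<mu>)"
proof -
  define J where "J = (\<integral>\<^sup>+s. ennreal (max (- real_of_int s) 0) \<partial>measure_pmf \<mu>)"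
  \<comment> \<open>Truncation deals with a positive part of infinite mean. A level \<open>L\<close>
    at which the truncated drift is already positive also serves as the offset of the Lyapunov
    function: a truncated exiting step is at most \<open>L\<close>.\<close>
  define I where "I L = (\<integral>\<^sup>+s. ennreal (min (max (real_of_int s) 0) (real L)) \<partial>measure_pmf \<mu>)" for L :: nat
  have "(\<integral>\<^sup>+s. ennreal (max (real_of_int s) 0) \<partial>measure_pmf \<mu>) = (\<integral>\<^sup>+s. (SUP L. ennreal (min (max (real_of_int s) 0) (real L))) \<partial>measure_pmf \<mu>)"
  proof (intro nn_integral_cong antisym)
    fix s :: int
    show "ennreal (max (real_of_int s) 0) \<le> (SUP L. ennreal (min (max (real_of_int s) 0) (real L)))"
      by (rule SUP_upper2[of "nat s"]) auto
    show "(SUP L. ennreal (min (max (real_of_int s) 0) (real L))) \<le> ennreal (max (real_of_int s) 0)"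
      by (intro SUP_least ennreal_leI) auto
  qed
  also have "\<dots> = (SUP L. I L)"
    unfolding I_def
    by (intro nn_integral_monotone_convergence_SUP) (auto simp: incseq_def le_fun_def intro!: ennreal_leI)
  finally have "J < (SUP L. I L)" using lt unfolding J_def by simp
  then obtain L where L: "J < I L" by (auto simp: less_SUP_iff)
  have J_fin: "J < \<infinity>" using less_le_trans[OF L, of \<infinity>] by simp
  define m where "m = I L - J"
  have m: "I L = m + J" "0 < m"
    using L J_fin unfolding m_def by (auto simp: diff_add_cancel_ennreal diff_gr0_ennreal less_imp_le)
  have drift: "(\<integral>\<^sup>+s. (if s \<le> int b then of_nat L + of_nat (nat (int b - s)) else 0) \<partial>measure_pmf \<mu>) + m \<le> of_nat L + of_nat b" for b
  proof -
    let ?X = "\<integral>\<^sup>+s. (if s \<le> int b then of_nat L + of_nat (nat (int b - s)) else 0) \<partial>measure_pmf \<mu>"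
    have pw: "(if s \<le> int b then of_nat L + of_nat (nat (int b - s)) else 0) + ennreal (min (max (real_of_int s) 0) (real L))
       \<le> ennreal (real L + real b) + ennreal (max (- real_of_int s) 0)" for s
      by (cases "s \<le> int b"; cases "s \<le> 0")
        (auto simp: ennreal_of_nat_eq_real_of_nat simp flip: ennreal_plus intro!: ennreal_leI)
    have "?X + I L = (\<integral>\<^sup>+s. ((if s \<le> int b then of_nat L + of_nat (nat (int b - s)) else 0) + ennreal (min (max (real_of_int s) 0) (real L))) \<partial>measure_pmf \<mu>)"
      unfolding I_def by (subst nn_integral_add) auto
    also have "\<dots> \<le> (\<integral>\<^sup>+s. (ennreal (real L + real b) + ennreal (max (- real_of_int s) 0)) \<partial>measure_pmf \<mu>)"
      by (intro nn_integral_mono pw)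
    also have "\<dots> = ennreal (real L + real b) + J"
      unfolding J_def by (subst nn_integral_add) (auto simp: measure_pmf.emeasure_space_1[simplified])
    finally have "J + (?X + m) \<le> J + (of_nat L + of_nat b)"
      unfolding m(1) by (simp add: ac_simps ennreal_of_nat_eq_real_of_nat)
    then show ?thesis using J_fin by (auto simp: ennreal_add_left_cancel_le)
  qed
  define S where "S = (\<Sum>n. below_sum \<mu> n (\<lambda>b. 1))"
  have "m * S \<le> of_nat L"
    unfolding S_def by (rule below_sum_drift[OF drift])
  then have S_fin: "S < \<infinity>"
    using m(2) by (metis ennreal_mult_top infinity_ennreal_def less_top not_gr_zero of_nat_less_top leD)
  show "(\<lambda>n. below_sum \<mu> n (\<lambda>b. 1)) \<longlonglongrightarrow> 0"
  proof (rule decseq_ennreal_LIMSEQ_0I[OF decseq_below_sum_one])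
    fix \<alpha> :: real assume \<alpha>: "0 < \<alpha>" "\<And>n. ennreal \<alpha> \<le> below_sum \<mu> n (\<lambda>b. 1)"
    have "of_nat N * ennreal \<alpha> \<le> S" for N
    proof -
      have "of_nat N * ennreal \<alpha> = (\<Sum>n<N. ennreal \<alpha>)" by simp
      also have "\<dots> \<le> (\<Sum>n<N. below_sum \<mu> n (\<lambda>b. 1))" by (intro sum_mono \<alpha>)
      also have "\<dots> \<le> S" unfolding S_def by (rule sum_le_suminf) auto
      finally show ?thesis .
    qed
    then have *: "ennreal (real N * \<alpha>) \<le> S" for N
      using \<alpha> by (simp add: ennreal_mult ennreal_of_nat_eq_real_of_nat)
    obtain r where r: "S = ennreal r" "0 \<le> r" using S_fin by (cases S) auto
    obtain N :: nat where "r / \<alpha> < real N" using reals_Archimedean2 by blast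
    then show False using *[of N] \<alpha> r by (simp add: field_simps)
  qed
  show "\<exists>C<\<infinity>. \<forall>k. ennreal (real k powr p) * (\<Sum>n. below_sum \<mu> n (\<lambda>b. emeasure \<mu> {int b + int k<..}))
      \<le> C * (\<integral>\<^sup>+s. ennreal (max (real_of_int s) 0 powr p) * indicator {int k<..} s \<partial>measure_pmf \<mu>)"
  proof (intro exI[of _ S] conjI allI S_fin)
    fix k :: nat
    have "(\<Sum>n. below_sum \<mu> n (\<lambda>b. emeasure \<mu> {int b + int k<..})) \<le> (\<Sum>n. below_sum \<mu> n (\<lambda>b. emeasure \<mu> {int k<..}))"
      by (intro suminf_le below_sum_mono emeasure_mono) auto
    also have "\<dots> = emeasure \<mu> {int k<..} * S"
      unfolding below_sum_const[where c = "emeasure \<mu> {int k<..}"] S_def by simp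
    finally have "ennreal (real k powr p) * (\<Sum>n. below_sum \<mu> n (\<lambda>b. emeasure \<mu> {int b + int k<..}))
       \<le> S * (ennreal (real k powr p) * emeasure \<mu> {int k<..})"
      by (subst mult.left_commute[of S]) (intro mult_left_mono, simp_all add: mult.commute)
    also have "ennreal (real k powr p) * emeasure \<mu> {int k<..} = (\<integral>\<^sup>+s. ennreal (real k powr p) * indicator {int k<..} s \<partial>measure_pmf \<mu>)"
      by (simp add: nn_integral_cmult)
    also have "\<dots> \<le> (\<integral>\<^sup>+s. ennreal (max (real_of_int s) 0 powr p) * indicator {int k<..} s \<partial>measure_pmf \<mu>)"
      using \<open>0 < p\<close> by (intro nn_integral_mono) (auto simp: indicator_def intro!: ennreal_leI powr_mono2)
    finally show "ennreal (real k powr p) * (\<Sum>n. below_sum \<mu> n (\<lambda>b. emeasure \<mu> {int b + int k<..}))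
      \<le> S * (\<integral>\<^sup>+s. ennreal (max (real_of_int s) 0 powr p) * indicator {int k<..} s \<partial>measure_pmf \<mu>)"
      by (simp add: mult_left_mono)
  qed
qed

text \<open>Each depth is visited at most \<open>c\<close> times in the mean, so the overshoot
  series is at most \<open>c\<close> times the step tails summed over all depths, that is,
  \<open>c\<close> times the mean of the positive part of \<open>s - k\<close>. Bounding
  \<open>s - k\<close> by \<open>s\<close> produces the exponent \<open>1 + p\<close>.\<close>

lemma centered_tail:
  assumes eq: "(\<integral>\<^sup>+s. ennreal (max (- real_of_int s) 0) \<partial>measure_pmf \<mu>) = (\<integral>\<^sup>+s. ennreal (max (real_of_int s) 0) \<partial>measure_pmf \<mu>)"
    and mom: "(\<integral>\<^sup>+s. ennreal (max (real_of_int s) 0 powr (1 + p)) \<partial>measure_pmf \<mu>) < \<infinity>"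
    and gcd: "Gcd (set_pmf \<mu>) = 1" and "0 < p"
  shows "(\<lambda>n. below_sum \<mu> n (\<lambda>b. 1)) \<longlonglongrightarrow> 0"
    and "\<exists>C<\<infinity>. \<forall>k. ennreal (real k powr p) * (\<Sum>n. below_sum \<mu> n (\<lambda>b. emeasure \<mu> {int b + int k<..}))
      \<le> C * (\<integral>\<^sup>+s. ennreal (max (real_of_int s) 0 powr (1 + p)) * indicator {int k<..} s \<partial>measure_pmf \<mu>)"
proof -
  define I where "I = (\<integral>\<^sup>+s. ennreal (max (real_of_int s) 0) \<partial>measure_pmf \<mu>)"
  \<comment> \<open>Integrality matters: a positive step is at least \<open>1\<close>, so raising
    the exponent does not decrease it.\<close>
  have powr_ge: "max (real_of_int s) 0 \<le> max (real_of_int s) 0 powr (1 + p)" for s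
  proof (cases "0 < s")
    case True
    then have "real_of_int s powr 1 \<le> real_of_int s powr (1 + p)"
      using \<open>0 < p\<close> by (intro powr_mono) auto
    then show ?thesis using True by (simp add: max_def)
  qed (simp add: max_def)
  have I_fin: "I < \<infinity>"
    unfolding I_def by (rule le_less_trans[OF nn_integral_mono mom]) (intro ennreal_leI powr_ge)
  have "\<not> (\<forall>s\<in>set_pmf \<mu>. 0 \<le> s)"
  proof
    assume "\<forall>s\<in>set_pmf \<mu>. 0 \<le> s"
    moreover from this have "\<forall>s\<in>set_pmf \<mu>. s \<le> 0"
      using eq nn_integral_neg_part_eq_0_iff[of \<mu>] nn_integral_pos_part_eq_0_iff[of \<mu>] by simp
    ultimately have "set_pmf \<mu> \<subseteq> {0}" by force
    then have "Gcd (set_pmf \<mu>) = 0" by simp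
    then show False using gcd by simp
  qed
  then obtain t where t: "t \<in> set_pmf \<mu>" "t < 0" by force
  define \<delta> where "\<delta> = measure_pmf.prob \<mu> {..<0}"
  have "0 < pmf \<mu> t" using t by (simp add: pmf_positive)
  also have "\<dots> \<le> \<delta>"
    unfolding \<delta>_def by (subst measure_pmf_single[symmetric]) (rule measure_pmf.finite_measure_mono, use t in auto)
  finally have "0 < \<delta>" .
  \<comment> \<open>The solution of \<open>1 + c * (1 - \<delta>) = c\<close>, where
    \<open>\<delta>\<close> is the probability of a strictly negative step.\<close>
  define c where "c = 1 / \<delta>"
  have "0 < c" using \<open>0 < \<delta>\<close> by (simp add: c_def)
  have "measure_pmf.prob \<mu> {0..} = 1 - \<delta>"
    using measure_pmf.prob_compl[of "{..<0}" \<mu>] unfolding \<delta>_def by (simp add: Compl_eq_Diff_UNIV[symmetric] not_less)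
  then have "1 + c * measure_pmf.prob \<mu> {0..} \<le> c"
    using \<open>0 < \<delta>\<close> by (simp add: c_def field_simps)
  then have "ennreal (1 + c * measure_pmf.prob \<mu> {0..}) \<le> ennreal c" by (rule ennreal_leI)
  then have "1 + ennreal c * emeasure \<mu> {0..} \<le> ennreal c"
    using \<open>0 < c\<close> by (simp add: ennreal_mult measure_pmf.emeasure_eq_measure)
  then have green: "(\<Sum>n<N. stay_below \<mu> n b) \<le> ennreal c" for N b
    by (rule stay_below_green_bound)
  \<comment> \<open>The positive part of \<open>b - s\<close> equals \<open>b - s\<close> plus the
    positive part of \<open>s - b\<close>; centering removes the mean of \<open>s\<close>, and the
    mean of the last part is the growth \<open>e b\<close> of the depth.\<close>
  define e where "e b = (\<integral>\<^sup>+s. ennreal (max (real_of_int s - real b) 0) \<partial>measure_pmf \<mu>)" for b :: nat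
  have centered: "(\<integral>\<^sup>+s. (if s \<le> int b then of_nat (nat (int b - s)) else 0) \<partial>measure_pmf \<mu>) = of_nat b + e b" for b
  proof -
    let ?X = "\<integral>\<^sup>+s. (if s \<le> int b then of_nat (nat (int b - s)) else 0) \<partial>measure_pmf \<mu>"
    have pw: "(if s \<le> int b then of_nat (nat (int b - s)) else 0) + ennreal (max (real_of_int s) 0)
       = (ennreal (real b) + ennreal (max (real_of_int s - real b) 0)) + ennreal (max (- real_of_int s) 0)" for s
      by (cases "s \<le> int b"; cases "s \<le> 0")
        (auto simp: ennreal_of_nat_eq_real_of_nat max_def simp flip: ennreal_plus intro!: arg_cong[of _ _ ennreal])
    have "?X + I = (\<integral>\<^sup>+s. ((if s \<le> int b then of_nat (nat (int b - s)) else 0) + ennreal (max (real_of_int s) 0)) \<partial>measure_pmf \<mu>)"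
      unfolding I_def by (subst nn_integral_add) auto
    also have "\<dots> = (ennreal (real b) + e b) + I"
      unfolding pw e_def I_def eq[symmetric]
      by (simp add: nn_integral_add measure_pmf.emeasure_space_1[simplified])
    finally have "I + ?X = I + (of_nat b + e b)"
      by (simp add: ac_simps ennreal_of_nat_eq_real_of_nat)
    then show ?thesis using I_fin by (auto simp: ennreal_add_left_cancel)
  qed
  have e_dec: "decseq e"
    unfolding e_def by (intro decseq_SucI nn_integral_mono ennreal_leI) auto
  have e_0: "e 0 < \<infinity>" using I_fin by (simp add: e_def I_def)
  have e_lim: "e \<longlonglongrightarrow> 0"
  proof (rule tendsto_sandwich[OF _ _ tendsto_const])
    show "eventually (\<lambda>n. 0 \<le> e n) sequentially" by simp
    show "eventually (\<lambda>n. e n \<le> (\<integral>\<^sup>+s. ennreal (max (real_of_int s) 0) * indicator {int n<..} s \<partial>measure_pmf \<mu>)) sequentially"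
      unfolding e_def by (intro always_eventually allI nn_integral_mono) (auto simp: indicator_def ennreal_eq_0_iff intro!: ennreal_leI)
    show "(\<lambda>n. \<integral>\<^sup>+s. ennreal (max (real_of_int s) 0) * indicator {int n<..} s \<partial>measure_pmf \<mu>) \<longlonglongrightarrow> 0"
      by (rule nn_integral_pmf_tail_tendsto_0) (use I_fin in \<open>simp add: I_def\<close>)
  qed
  show "(\<lambda>n. below_sum \<mu> n (\<lambda>b. 1)) \<longlonglongrightarrow> 0"
    by (rule below_sum_centered_tendsto_0[OF green \<open>0 < c\<close> centered e_dec e_lim e_0])
  have green_inf: "(\<Sum>n. stay_below \<mu> n b) \<le> ennreal c" for b
    unfolding suminf_eq_SUP by (intro SUP_least green)
  show "\<exists>C<\<infinity>. \<forall>k. ennreal (real k powr p) * (\<Sum>n. below_sum \<mu> n (\<lambda>b. emeasure \<mu> {int b + int k<..}))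
      \<le> C * (\<integral>\<^sup>+s. ennreal (max (real_of_int s) 0 powr (1 + p)) * indicator {int k<..} s \<partial>measure_pmf \<mu>)"
  proof (intro exI[of _ "ennreal c"] conjI allI)
    fix k :: nat
    have "(\<Sum>n. below_sum \<mu> n (\<lambda>b. emeasure \<mu> {int b + int k<..}))
        = (\<Sum>b. \<Sum>n. stay_below \<mu> n b * emeasure \<mu> {int b + int k<..})"
      unfolding below_sum_def by (rule suminf_swap_ennreal)
    also have "\<dots> \<le> (\<Sum>b. ennreal c * emeasure \<mu> {int b + int k<..})"
      unfolding ennreal_suminf_multc by (intro suminf_le mult_right_mono green_inf) auto
    also have "\<dots> = ennreal c * (\<integral>\<^sup>+s. (\<Sum>b. indicator {int b + int k<..} s) \<partial>measure_pmf \<mu>)"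
      by (subst nn_integral_suminf) simp_all
    finally have "ennreal (real k powr p) * (\<Sum>n. below_sum \<mu> n (\<lambda>b. emeasure \<mu> {int b + int k<..}))
       \<le> ennreal c * (ennreal (real k powr p) * (\<integral>\<^sup>+s. (\<Sum>b. indicator {int b + int k<..} s) \<partial>measure_pmf \<mu>))"
      by (subst mult.left_commute[of "ennreal c"]) (rule mult_left_mono, simp_all)
    also have "ennreal (real k powr p) * (\<integral>\<^sup>+s. (\<Sum>b. indicator {int b + int k<..} s) \<partial>measure_pmf \<mu>)
      = (\<integral>\<^sup>+s. ennreal (real k powr p) * (\<Sum>b. indicator {int b + int k<..} s) \<partial>measure_pmf \<mu>)"
      by (rule nn_integral_cmult[symmetric]) simp
    also have "\<dots> \<le> (\<integral>\<^sup>+s. ennreal (max (real_of_int s) 0 powr (1 + p)) * indicator {int k<..} s \<partial>measure_pmf \<mu>)"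
    proof (intro nn_integral_mono)
      fix s :: int
      have sum_eq: "(\<Sum>b. indicator {int b + int k<..} s :: ennreal) = of_nat (nat (s - int k))"
      proof -
        have "(\<Sum>b. indicator {int b + int k<..} s :: ennreal) = (\<Sum>b<nat (s - int k). indicator {int b + int k<..} s)"
          by (rule suminf_finite) (auto simp: indicator_def)
        also have "\<dots> = (\<Sum>b<nat (s - int k). 1)"
          by (rule sum.cong) (auto simp: indicator_def)
        finally show ?thesis by simp
      qed
      show "ennreal (real k powr p) * (\<Sum>b. indicator {int b + int k<..} s)
        \<le> ennreal (max (real_of_int s) 0 powr (1 + p)) * indicator {int k<..} s"
      proof (cases "int k < s")
        case True
        have "real k powr p * real (nat (s - int k)) \<le> real_of_int s powr p * real_of_int s"
          using True \<open>0 < p\<close> by (intro mult_mono powr_mono2) auto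
        also have "\<dots> = real_of_int s powr (1 + p)"
          using True by (simp add: powr_add mult.commute)
        finally show ?thesis
          using True unfolding sum_eq
          by (simp add: ennreal_of_nat_eq_real_of_nat max_def ennreal_leI flip: ennreal_mult)
      next
        case False
        then show ?thesis unfolding sum_eq by simp
      qed
    qed
    finally show "ennreal (real k powr p) * (\<Sum>n. below_sum \<mu> n (\<lambda>b. emeasure \<mu> {int b + int k<..}))
      \<le> ennreal c * (\<integral>\<^sup>+s. ennreal (max (real_of_int s) 0 powr (1 + p)) * indicator {int k<..} s \<partial>measure_pmf \<mu>)"
      by (simp add: mult_left_mono)
  qed simp
qed

text \<open>Both regimes bound the weighted tail by a constant times a moment integral over
  \<open>{k<..}\<close>, with exponent \<open>p\<close> or \<open>1 + p\<close>. Restricting the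
  integral to large steps, rather than using the full moment, is what yields convergence to
  \<open>0\<close>.\<close>

lemma upward_ladder_decay:
  assumes up: "upward p \<mu>" and gcd: "Gcd (set_pmf \<mu>) = 1" and "0 < p"
  shows "(\<lambda>k. real k powr p * (1 - (\<Sum>i<k. enn2real (ladder \<mu> i)))) \<longlonglongrightarrow> 0"
proof -
  let ?T = "\<lambda>k::nat. \<Sum>n. below_sum \<mu> n (\<lambda>b. emeasure \<mu> {int b + int k<..})"
  have "(\<lambda>n. below_sum \<mu> n (\<lambda>b. 1)) \<longlonglongrightarrow> 0 \<and>
    (\<exists>C r. C < \<infinity> \<and> (\<integral>\<^sup>+s. ennreal (max (real_of_int s) 0 powr r) \<partial>measure_pmf \<mu>) < \<infinity> \<and>
     (\<forall>k. ennreal (real k powr p) * ?T k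
       \<le> C * (\<integral>\<^sup>+s. ennreal (max (real_of_int s) 0 powr r) * indicator {int k<..} s \<partial>measure_pmf \<mu>)))"
    using up drift_tail[of \<mu> p] centered_tail[of \<mu> p] gcd \<open>0 < p\<close> unfolding upward_def by blast
  then obtain C r where vanish: "(\<lambda>n. below_sum \<mu> n (\<lambda>b. 1)) \<longlonglongrightarrow> 0" and C: "C < \<infinity>"
    and r: "(\<integral>\<^sup>+s. ennreal (max (real_of_int s) 0 powr r) \<partial>measure_pmf \<mu>) < \<infinity>"
    and bound: "\<And>k. ennreal (real k powr p) * ?T k
       \<le> C * (\<integral>\<^sup>+s. ennreal (max (real_of_int s) 0 powr r) * indicator {int k<..} s \<partial>measure_pmf \<mu>)"
    by blast
  define u where "u k = C * (\<integral>\<^sup>+s. ennreal (max (real_of_int s) 0 powr r) * indicator {int k<..} s \<partial>measure_pmf \<mu>)" for k :: nat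
  have "u \<longlonglongrightarrow> C * 0"
    unfolding u_def using C
    by (intro ennreal_tendsto_cmult nn_integral_pmf_tail_tendsto_0 r) (simp add: less_top)
  then have u_lim: "(\<lambda>k. enn2real (u k)) \<longlonglongrightarrow> 0"
    using tendsto_enn2real[of u 0] by simp
  have u_fin: "u k < \<infinity>" for k
  proof -
    have "(\<integral>\<^sup>+s. ennreal (max (real_of_int s) 0 powr r) * indicator {int k<..} s \<partial>measure_pmf \<mu>)
      \<le> (\<integral>\<^sup>+s. ennreal (max (real_of_int s) 0 powr r) \<partial>measure_pmf \<mu>)"
      by (intro nn_integral_mono) (auto simp: indicator_def)
    then show ?thesis using C r unfolding u_def by (simp add: ennreal_mult_less_top less_top order_le_less_trans)
  qed
  have lad_sum: "(\<Sum>i<k. ladder \<mu> i) = ennreal (\<Sum>i<k. enn2real (ladder \<mu> i))" for k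
    using ladder_finite by (simp add: sum_ennreal[symmetric] less_top)
  have upper: "real k powr p * (1 - (\<Sum>i<k. enn2real (ladder \<mu> i))) \<le> enn2real (u k)" for k
  proof -
    have "ennreal (real k powr p) \<le> ennreal (real k powr p) * ((\<Sum>i<k. ladder \<mu> i) + ?T k)"
      using mult_left_mono[OF ladder_tail[OF vanish, of k], of "ennreal (real k powr p)"] by simp
    also have "\<dots> \<le> ennreal (real k powr p) * (\<Sum>i<k. ladder \<mu> i) + u k"
      unfolding distrib_left u_def by (intro add_left_mono bound)
    also have "\<dots> = ennreal (real k powr p * (\<Sum>i<k. enn2real (ladder \<mu> i)) + enn2real (u k))"
      using u_fin[of k] by (simp add: lad_sum ennreal_mult sum_nonneg)
    finally have "real k powr p \<le> real k powr p * (\<Sum>i<k. enn2real (ladder \<mu> i)) + enn2real (u k)"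
      by (subst (asm) ennreal_le_iff) (auto intro!: add_nonneg_nonneg mult_nonneg_nonneg sum_nonneg)
    then show ?thesis by (simp add: algebra_simps)
  qed
  have lower: "0 \<le> real k powr p * (1 - (\<Sum>i<k. enn2real (ladder \<mu> i)))" for k
    using sum_ladder_le_1[of \<mu> k] unfolding lad_sum by simp
  show ?thesis
    by (rule tendsto_sandwich[OF always_eventually always_eventually tendsto_const u_lim]) (use lower upper in auto)
qed

section \<open>Superharmonic functions of the oscillating walk\<close>

text \<open>
  The truncated invariance of the measure \<open>a\<close>, \<open>b\<close>: the terms \<open>a (z + k) * b k - a (z + k + 1) * b (k + 1)\<close>
  telescope, and each is the mass that reaches \<open>z\<close> from \<open>z + k + 1\<close> and from \<open>- 1 - k\<close>.
\<close>

lemma one_sided_invariance: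
  fixes a b :: "nat \<Rightarrow> real"
  assumes a: "decseq a" "\<And>k. 0 \<le> a k" and b: "decseq b" "\<And>k. 0 \<le> b k" "b 0 = 1" and "z < R"
  shows "a z \<le> (\<Sum>x<R. if z < x then a x * (b (x - z - 1) - b (x - z)) else 0)
            + (\<Sum>j<R. b j * (a (z + j) - a (z + j + 1))) + a R * b (R - 1 - z)"
proof -
  let ?V = "\<lambda>k. a (z + k + 1) * (b k - b (k + 1))"
  let ?H = "\<lambda>k. b k * (a (z + k) - a (z + k + 1))"
  obtain n where n: "R = z + n + 1" using \<open>z < R\<close> less_imp_Suc_add by fastforce
  have tele: "(\<Sum>k<m. ?V k + ?H k) = a z - a (z + m) * b m" for m
    by (induction m) (simp_all add: \<open>b 0 = 1\<close> algebra_simps)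
  have "(\<Sum>k<n. ?V k) = (\<Sum>x\<in>{z+1..<z+1+n}. a x * (b (x - z - 1) - b (x - z)))"
    by (rule sum.reindex_bij_witness[of _ "\<lambda>x. x - z - 1" "\<lambda>k. z + k + 1"]) auto
  also have "\<dots> = (\<Sum>x<R. if z < x then a x * (b (x - z - 1) - b (x - z)) else 0)"
  proof -
    have "{..<R} \<inter> {x. z < x} = {z+1..<z+1+n}" by (auto simp: n)
    then show ?thesis by (simp add: sum.If_cases)
  qed
  finally have V: "(\<Sum>k<n. ?V k) = (\<Sum>x<R. if z < x then a x * (b (x - z - 1) - b (x - z)) else 0)" .
  have H: "(\<Sum>k<Suc n. ?H k) \<le> (\<Sum>j<R. ?H j)"
    using a(1) b(2) by (intro sum_mono2) (auto simp: n decseq_def)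
  have "a z = a R * b (Suc n) + (\<Sum>k<Suc n. ?V k + ?H k)"
    unfolding tele by (simp add: n)
  also have "\<dots> = a R * b (Suc n) + (\<Sum>k<n. ?V k) + ?V n + (\<Sum>k<Suc n. ?H k)"
    by (simp only: sum.distrib sum.lessThan_Suc ac_simps)
  \<comment> \<open>\<open>?V n\<close> is the mass arriving from \<open>R\<close>, the first state
    outside the window. Together with the telescoping remainder it forms the boundary term.\<close>
  also have "a R * b (Suc n) + (\<Sum>k<n. ?V k) + ?V n = (\<Sum>k<n. ?V k) + a R * b n"
    by (simp add: n algebra_simps)
  finally show ?thesis using H unfolding V by (simp add: n)
qed

text \<open>Here \<open>f y\<close> and \<open>g y\<close> stand for the values of \<open>h\<close>
  at \<open>y\<close> and at \<open>- 1 - y\<close>, and \<open>Kf\<close>, \<open>Kg\<close> for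
  the one-step means of the original walk. The weighted sums are regrouped by arrival state, because
  invariance balances what enters a state.\<close>

lemma one_sided_window:
  fixes a b f g Kf Kg :: "nat \<Rightarrow> real"
  assumes a: "decseq a" "\<And>k. 0 \<le> a k" "a 0 = 1" and b: "decseq b" "\<And>k. 0 \<le> b k" "b 0 = 1"
    and f: "\<And>y. 0 \<le> f y" "\<And>y. f y \<le> 1" and g: "\<And>y. 0 \<le> g y" "\<And>y. g y \<le> 1"
    and Kf: "\<And>x. (\<Sum>y<R. if y < x then (b (x - y - 1) - b (x - y)) * f y else 0)
        + (\<Sum>j<R. (b (x + j) - b (x + j + 1)) * g j) \<le> Kf x"
    and Kg: "\<And>x. (\<Sum>y<R. if y < x then (a (x - y - 1) - a (x - y)) * g y else 0)
        + (\<Sum>j<R. (a (x + j) - a (x + j + 1)) * f j) \<le> Kg x"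
    and super: "\<And>x. Kf x \<le> f x" "\<And>x. Kg x \<le> g x"
    and "0 < R"
  shows "f 0 - Kf 0 \<le> a R * (\<Sum>k<R. b k) + b R * (\<Sum>k<R. a k)"
proof -
  \<comment> \<open>One half-line as the set of arrival states: \<open>u\<close> is its invariant
    weight, \<open>v\<close> that of the other one. Jumps inside it follow the differences of
    \<open>v\<close>, jumps into it from the other side those of \<open>u\<close>. Both half-lines
    are instances.\<close>
  have half: "(\<Sum>x<R. u x * \<phi> x)
     - (\<Sum>x<R. u x * (\<Sum>y<R. if y < x then (v (x - y - 1) - v (x - y)) * \<phi> y else 0))
     - (\<Sum>x<R. v x * (\<Sum>j<R. (u (x + j) - u (x + j + 1)) * \<phi> j)) \<le> u R * (\<Sum>k<R. v k)"
    if u: "decseq u" "\<And>k. 0 \<le> u k" and v: "decseq v" "\<And>k. 0 \<le> v k" "v 0 = 1"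
      and \<phi>: "\<And>y. 0 \<le> \<phi> y" "\<And>y. \<phi> y \<le> 1" for u v \<phi> :: "nat \<Rightarrow> real"
  proof -
    have 1: "(\<Sum>x<R. u x * (\<Sum>y<R. if y < x then (v (x - y - 1) - v (x - y)) * \<phi> y else 0))
      = (\<Sum>y<R. \<phi> y * (\<Sum>x<R. if y < x then u x * (v (x - y - 1) - v (x - y)) else 0))"
      by (simp add: sum_distrib_left, subst sum.swap) (intro sum.cong refl, simp)
    have 2: "(\<Sum>x<R. v x * (\<Sum>j<R. (u (x + j) - u (x + j + 1)) * \<phi> j))
      = (\<Sum>y<R. \<phi> y * (\<Sum>j<R. v j * (u (y + j) - u (y + j + 1))))"
      by (simp add: sum_distrib_left, subst sum.swap) (intro sum.cong refl, simp add: add.commute)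
    have "(\<Sum>x<R. u x * \<phi> x)
     - (\<Sum>x<R. u x * (\<Sum>y<R. if y < x then (v (x - y - 1) - v (x - y)) * \<phi> y else 0))
     - (\<Sum>x<R. v x * (\<Sum>j<R. (u (x + j) - u (x + j + 1)) * \<phi> j))
     = (\<Sum>y<R. \<phi> y * (u y - (\<Sum>x<R. if y < x then u x * (v (x - y - 1) - v (x - y)) else 0)
          - (\<Sum>j<R. v j * (u (y + j) - u (y + j + 1)))))"
      unfolding 1 2 by (simp add: sum_subtractf right_diff_distrib mult.commute)
    also have "\<dots> \<le> (\<Sum>y<R. u R * v (R - 1 - y))"
    proof (rule sum_mono)
      fix y assume "y \<in> {..<R}"
      then have *: "u y - (\<Sum>x<R. if y < x then u x * (v (x - y - 1) - v (x - y)) else 0)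
          - (\<Sum>j<R. v j * (u (y + j) - u (y + j + 1))) \<le> u R * v (R - 1 - y)"
        using one_sided_invariance[OF u v, of y R] by simp
      have "\<phi> y * (u y - (\<Sum>x<R. if y < x then u x * (v (x - y - 1) - v (x - y)) else 0)
          - (\<Sum>j<R. v j * (u (y + j) - u (y + j + 1)))) \<le> \<phi> y * (u R * v (R - 1 - y))"
        by (intro mult_left_mono * \<phi>)
      also have "\<dots> \<le> 1 * (u R * v (R - 1 - y))"
        by (intro mult_right_mono \<phi> mult_nonneg_nonneg u v)
      finally show "\<phi> y * (u y - (\<Sum>x<R. if y < x then u x * (v (x - y - 1) - v (x - y)) else 0)
          - (\<Sum>j<R. v j * (u (y + j) - u (y + j + 1)))) \<le> u R * v (R - 1 - y)" by simp
    qed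
    also have "\<dots> = u R * (\<Sum>k<R. v k)"
      by (subst sum.nat_diff_reindex[symmetric, of v]) (simp add: sum_distrib_left)
    finally show ?thesis .
  qed
  have "f 0 - Kf 0 = a 0 * (f 0 - Kf 0)" by (simp add: \<open>a 0 = 1\<close>)
  \<comment> \<open>All defects are nonnegative, so the single defect at \<open>0\<close> can be
    replaced by the weighted total over the window.\<close>
  also have "\<dots> \<le> (\<Sum>x<R. a x * (f x - Kf x))"
    by (rule member_le_sum) (use \<open>0 < R\<close> a super in \<open>auto intro: mult_nonneg_nonneg\<close>)
  also have "\<dots> \<le> (\<Sum>x<R. a x * (f x - Kf x)) + (\<Sum>x<R. b x * (g x - Kg x))"
    using b super by (auto intro!: sum_nonneg mult_nonneg_nonneg)
  also have "\<dots> \<le> (\<Sum>x<R. a x * (f x - ((\<Sum>y<R. if y < x then (b (x - y - 1) - b (x - y)) * f y else 0)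
        + (\<Sum>j<R. (b (x + j) - b (x + j + 1)) * g j))))
      + (\<Sum>x<R. b x * (g x - ((\<Sum>y<R. if y < x then (a (x - y - 1) - a (x - y)) * g y else 0)
        + (\<Sum>j<R. (a (x + j) - a (x + j + 1)) * f j))))"
    using a b Kf Kg by (intro add_mono sum_mono mult_left_mono diff_left_mono) auto
  also have "\<dots> = ((\<Sum>x<R. a x * f x)
     - (\<Sum>x<R. a x * (\<Sum>y<R. if y < x then (b (x - y - 1) - b (x - y)) * f y else 0))
     - (\<Sum>x<R. b x * (\<Sum>j<R. (a (x + j) - a (x + j + 1)) * f j)))
     + ((\<Sum>x<R. b x * g x)
     - (\<Sum>x<R. b x * (\<Sum>y<R. if y < x then (a (x - y - 1) - a (x - y)) * g y else 0))
     - (\<Sum>x<R. a x * (\<Sum>j<R. (b (x + j) - b (x + j + 1)) * g j)))"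
    by (simp only: right_diff_distrib distrib_left sum_subtractf sum.distrib)
  also have "\<dots> \<le> a R * (\<Sum>k<R. b k) + b R * (\<Sum>k<R. a k)"
    by (intro add_mono half a b f g)
  finally show ?thesis .
qed

section \<open>Decay of the boundary term\<close>

lemma sum_powr_le:
  fixes p q :: real
  assumes "0 < p" "0 < q" "p + q = 1"
  shows "p * (\<Sum>k<R. (real k + 1) powr (- q)) \<le> real R powr p"
proof (induction R)
  case (Suc R)
  \<comment> \<open>The induction step multiplied by \<open>(real R + 1) powr q\<close>. It is the
    weighted AM-GM inequality, since \<open>p * R + q * (R + 1) = R + 1 - p\<close>.\<close>
  have "real R powr p * (real R + 1) powr q \<le> real R + 1 - p"
  proof (cases "R = 0")
    case False
    have "p * real R + q * (real R + 1) = (p + q) * (real R + 1) - p" by (simp add: algebra_simps)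
    then show ?thesis
      using Youngs_inequality_0[of p q "real R" "real R + 1"] assms False by simp
  qed (use assms in simp)
  then have "real R powr p * (real R + 1) powr q * (real R + 1) powr (- q) \<le> (real R + 1 - p) * (real R + 1) powr (- q)"
    by (rule mult_right_mono) simp
  moreover have "real R powr p * (real R + 1) powr q * (real R + 1) powr (- q) = real R powr p"
    by (simp add: mult.assoc flip: powr_add)
  moreover have "(real R + 1) * (real R + 1) powr (- q) = (real R + 1) powr p"
  proof -
    have "p = 1 + (- q)" using assms by simp
    then show ?thesis by (simp only: powr_add) simp
  qed
  ultimately have "real R powr p + p * (real R + 1) powr (- q) \<le> (real R + 1) powr p"
    by (simp add: left_diff_distrib)
  then show ?case using Suc.IH by (simp add: distrib_left add.commute)
qed (use assms in simp)

text \<open>Boundedness of \<open>k powr q * b k\<close> already gives partial sums of order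
  \<open>R powr p\<close>; the little-o decay of \<open>a\<close> then sends the product to
  \<open>0\<close>.\<close>

lemma tail_product_tendsto_0:
  fixes a b :: "nat \<Rightarrow> real" and p q :: real
  assumes pq: "0 < p" "0 < q" "p + q = 1"
    and a: "\<And>k. 0 \<le> a k" "(\<lambda>k. real k powr p * a k) \<longlonglongrightarrow> 0"
    and b: "decseq b" "\<And>k. 0 \<le> b k" "(\<lambda>k. real k powr q * b k) \<longlonglongrightarrow> 0"
  shows "(\<lambda>R. a R * (\<Sum>k<R. b k)) \<longlonglongrightarrow> 0"
proof -
  obtain C where C: "\<And>k. real k powr q * b k \<le> C"
    using convergent_imp_Bseq[OF convergentI[OF b(3)]] unfolding Bseq_def
    by (metis abs_le_D1 real_norm_def)
  \<comment> \<open>The summand \<open>b 0\<close> covers \<open>k = 0\<close>, where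
    \<open>0 powr q = 0\<close> makes \<open>C\<close> say nothing. The factor \<open>2\<close>
    comes from \<open>k + 1 \<le> 2 * k\<close> and \<open>q < 1\<close>.\<close>
  define D where "D = b 0 + 2 * \<bar>C\<bar>"
  have b_le: "b k \<le> D * (real k + 1) powr (- q)" for k
  proof (cases "k = 0")
    case False
    have "(real k + 1) powr q \<le> (2 * real k) powr q"
      using False pq by (intro powr_mono2) auto
    also have "\<dots> = 2 powr q * real k powr q" by (simp add: powr_mult)
    also have "\<dots> \<le> 2 powr 1 * real k powr q"
      using pq by (intro mult_right_mono powr_mono) auto
    finally have "(real k + 1) powr q * b k \<le> 2 * real k powr q * b k"
      using b(2) by (intro mult_right_mono) auto
    also have "\<dots> \<le> D" using C[of k] b(2)[of 0] by (simp add: D_def)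
    finally show ?thesis by (simp add: powr_minus field_simps)
  qed (simp add: D_def)
  have "0 \<le> D" using b(2)[of 0] by (simp add: D_def)
  have upper: "a R * (\<Sum>k<R. b k) \<le> (D / p) * (real R powr p * a R)" for R
  proof -
    have "(\<Sum>k<R. b k) \<le> (\<Sum>k<R. D * (real k + 1) powr (- q))" by (intro sum_mono b_le)
    also have "\<dots> = (D / p) * (p * (\<Sum>k<R. (real k + 1) powr (- q)))"
      using pq by (simp add: sum_distrib_left)
    also have "\<dots> \<le> (D / p) * real R powr p"
      using \<open>0 \<le> D\<close> pq by (intro mult_left_mono sum_powr_le) auto
    finally have "a R * (\<Sum>k<R. b k) \<le> a R * ((D / p) * real R powr p)"
      by (rule mult_left_mono) (rule a)
    then show ?thesis by (simp add: ac_simps)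
  qed
  have lim: "(\<lambda>R. (D / p) * (real R powr p * a R)) \<longlonglongrightarrow> 0"
    using tendsto_mult_left[OF a(2), of "D / p"] by simp
  show ?thesis
    by (rule tendsto_sandwich[OF always_eventually always_eventually tendsto_const lim])
      (use upper a b in \<open>auto intro!: mult_nonneg_nonneg sum_nonneg\<close>)
qed

section \<open>From ladder steps to the oscillating walk\<close>

definition osc_step :: "int pmf \<Rightarrow> int pmf \<Rightarrow> int \<Rightarrow> int pmf" where
  "osc_step \<mu> \<mu>' x = map_pmf (\<lambda>s. x + s) (if x \<le> - 1 then \<mu> else \<mu>')"

lemma ladder_superharmonic_real:
  fixes h :: "int \<Rightarrow> real"
  assumes h: "\<And>y. 0 \<le> h y" "\<And>y. h y \<le> 1"
    and super: "\<And>y. y \<le> x \<Longrightarrow> measure_pmf.expectation \<mu> (\<lambda>s. h (y + s)) \<le> h y"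
  shows "(\<Sum>i<N. enn2real (ladder \<mu> i) * h (x + 1 + int i)) \<le> measure_pmf.expectation \<mu> (\<lambda>s. h (x + s))"
proof -
  have int: "integrable (measure_pmf \<mu>) (\<lambda>s. h (y + s))" for y
    using h by (intro measure_pmf.integrable_const_bound[where B = 1]) auto
  have eq: "(\<integral>\<^sup>+s. ennreal (h (y + s)) \<partial>measure_pmf \<mu>) = ennreal (measure_pmf.expectation \<mu> (\<lambda>s. h (y + s)))" for y
    by (intro nn_integral_eq_integral int) (use h in auto)
  have "ennreal (\<Sum>i<N. enn2real (ladder \<mu> i) * h (x + 1 + int i)) = (\<Sum>i<N. ladder \<mu> i * ennreal (h (x + 1 + int i)))"
    using ladder_finite h by (simp add: sum_ennreal[symmetric] ennreal_mult less_top)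
  also have "\<dots> \<le> (\<integral>\<^sup>+s. ennreal (h (x + s)) \<partial>measure_pmf \<mu>)"
    by (rule ladder_superharmonic) (simp add: eq super ennreal_leI)
  finally show ?thesis unfolding eq
    by (subst (asm) ennreal_le_iff) (auto intro!: integral_nonneg_AE h)
qed

definition ladder_tail_prob :: "int pmf \<Rightarrow> nat \<Rightarrow> real" where
  "ladder_tail_prob \<mu> k = 1 - (\<Sum>i<k. enn2real (ladder \<mu> i))"

lemma ladder_tail_prob_nonneg: "0 \<le> ladder_tail_prob \<mu> k"
  using ladder_superharmonic_real[where h = "\<lambda>_. 1" and x = 0 and \<mu> = \<mu> and N = k]
  by (simp add: ladder_tail_prob_def)

lemma ladder_tail_prob_0 [simp]: "ladder_tail_prob \<mu> 0 = 1"
  by (simp add: ladder_tail_prob_def)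

lemma ladder_tail_prob_diff: "ladder_tail_prob \<mu> k - ladder_tail_prob \<mu> (k + 1) = enn2real (ladder \<mu> k)"
  by (simp add: ladder_tail_prob_def)

lemma decseq_ladder_tail_prob: "decseq (ladder_tail_prob \<mu>)"
  by (rule decseq_SucI) (simp add: ladder_tail_prob_def)

text \<open>The index \<open>x\<close> encodes the state \<open>- 1 - x\<close>. A ladder step of
  height \<open>i + 1\<close> lands at the negative state with index \<open>x - 1 - i\<close> if
  \<open>i < x\<close>, and at \<open>i - x\<close> otherwise. Before this step the walk does not
  rise above its start, so superharmonicity on the negative states suffices; cutting at
  \<open>R\<close> only drops nonnegative terms.\<close>

lemma ladder_window:
  fixes h :: "int \<Rightarrow> real"
  assumes h: "\<And>y. 0 \<le> h y" "\<And>y. h y \<le> 1"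
    and super: "\<And>y. y < 0 \<Longrightarrow> measure_pmf.expectation \<mu> (\<lambda>s. h (y + s)) \<le> h y"
  defines "a \<equiv> ladder_tail_prob \<mu>"
  shows "(\<Sum>y<R. if y < x then (a (x - y - 1) - a (x - y)) * h (- 1 - int y) else 0)
        + (\<Sum>j<R. (a (x + j) - a (x + j + 1)) * h (int j))
      \<le> measure_pmf.expectation \<mu> (\<lambda>s. h (- 1 - int x + s))"
proof -
  let ?t = "\<lambda>i. enn2real (ladder \<mu> i) * h (- 1 - int x + 1 + int i)"
  have "(\<Sum>y<R. if y < x then (a (x - y - 1) - a (x - y)) * h (- 1 - int y) else 0)
    \<le> (\<Sum>y<x. (a (x - y - 1) - a (x - y)) * h (- 1 - int y))"
  proof -
    have "(\<Sum>y<R. if y < x then (a (x - y - 1) - a (x - y)) * h (- 1 - int y) else 0)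
      = (\<Sum>y\<in>{..<R} \<inter> {y. y < x}. (a (x - y - 1) - a (x - y)) * h (- 1 - int y))"
      by (simp add: sum.If_cases)
    also have "\<dots> \<le> (\<Sum>y<x. (a (x - y - 1) - a (x - y)) * h (- 1 - int y))"
      using decseq_ladder_tail_prob[of \<mu>] h unfolding a_def
      by (intro sum_mono2) (auto intro!: mult_nonneg_nonneg simp: decseq_def)
    finally show ?thesis .
  qed
  also have "\<dots> = (\<Sum>i<x. ?t i)"
  proof (rule sum.reindex_bij_witness[of _ "\<lambda>i. x - 1 - i" "\<lambda>y. x - 1 - y"])
    fix y assume y: "y \<in> {..<x}"
    then have "a (x - y - 1) - a (x - y) = enn2real (ladder \<mu> (x - 1 - y))"
      using ladder_tail_prob_diff[of \<mu> "x - 1 - y"] unfolding a_def by (simp add: Suc_diff_Suc)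
    then show "enn2real (ladder \<mu> (x - 1 - y)) * h (- 1 - int x + 1 + int (x - 1 - y))
        = (a (x - y - 1) - a (x - y)) * h (- 1 - int y)"
      using y by (simp add: algebra_simps)
  qed auto
  finally have 1: "(\<Sum>y<R. if y < x then (a (x - y - 1) - a (x - y)) * h (- 1 - int y) else 0) \<le> (\<Sum>i<x. ?t i)" .
  have 2: "(\<Sum>j<R. (a (x + j) - a (x + j + 1)) * h (int j)) = (\<Sum>i=x..<x+R. ?t i)"
    unfolding a_def ladder_tail_prob_diff
    by (rule sum.reindex_bij_witness[of _ "\<lambda>i. i - x" "\<lambda>j. x + j"]) auto
  have "(\<Sum>i<x. ?t i) + (\<Sum>i=x..<x+R. ?t i) = (\<Sum>i<x+R. ?t i)"
    by (simp add: lessThan_atLeast0 sum.atLeastLessThan_concat)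
  also have "\<dots> \<le> measure_pmf.expectation \<mu> (\<lambda>s. h (- 1 - int x + s))"
    by (rule ladder_superharmonic_real) (use h super in auto)
  finally show ?thesis using 1 2 by linarith
qed

lemma Gcd_uminus_image: "Gcd (uminus ` S) = Gcd (S :: int set)"
  using Gcd_abs_eq[of "uminus ` S"] Gcd_abs_eq[of S] by (simp add: image_image)

lemma superharmonic_eq_at_0:
  fixes h :: "int \<Rightarrow> real"
  assumes up: "upward p \<mu>" "upward q (map_pmf uminus \<mu>')"
    and gcd: "Gcd (set_pmf \<mu>) = 1" "Gcd (set_pmf \<mu>') = 1"
    and pq: "0 < p" "0 < q" "p + q = 1"
    and h: "\<And>y. 0 \<le> h y" "\<And>y. h y \<le> 1"
    and super: "\<And>y. measure_pmf.expectation (osc_step \<mu> \<mu>' y) h \<le> h y"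
  shows "h 0 \<le> measure_pmf.expectation (osc_step \<mu> \<mu>' 0) h"
proof -
  define \<nu> where "\<nu> = map_pmf uminus \<mu>'"
  define a where "a = ladder_tail_prob \<mu>"
  define b where "b = ladder_tail_prob \<nu>"
  have gcd': "Gcd (set_pmf \<nu>) = 1"
    using gcd(2) by (simp add: \<nu>_def Gcd_uminus_image)
  have E_neg: "measure_pmf.expectation (osc_step \<mu> \<mu>' y) h = measure_pmf.expectation \<mu> (\<lambda>s. h (y + s))" if "y < 0" for y
    using that by (simp add: osc_step_def)
  have E_nonneg: "measure_pmf.expectation (osc_step \<mu> \<mu>' y) h = measure_pmf.expectation \<nu> (\<lambda>s. h (y - s))" if "0 \<le> y" for y
    using that by (simp add: osc_step_def \<nu>_def)
  have Kg: "(\<Sum>y<R. if y < x then (a (x - y - 1) - a (x - y)) * h (- 1 - int y) else 0)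
        + (\<Sum>j<R. (a (x + j) - a (x + j + 1)) * h (int j))
      \<le> measure_pmf.expectation (osc_step \<mu> \<mu>' (- 1 - int x)) h" for x R
  proof -
    have "measure_pmf.expectation \<mu> (\<lambda>s. h (y + s)) \<le> h y" if "y < 0" for y
      using super[of y] that by (simp add: E_neg)
    from ladder_window[OF h this, of x R] show ?thesis
      unfolding a_def by (simp add: E_neg)
  qed
  have Kf: "(\<Sum>y<R. if y < x then (b (x - y - 1) - b (x - y)) * h (int y) else 0)
        + (\<Sum>j<R. (b (x + j) - b (x + j + 1)) * h (- 1 - int j))
      \<le> measure_pmf.expectation (osc_step \<mu> \<mu>' (int x)) h" for x R
  proof -
    \<comment> \<open>The reflection \<open>y \<mapsto> - 1 - y\<close> exchanges the two
      half-lines, so descending ladder steps of \<open>\<mu>'\<close> become ascending ones of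
      \<open>\<nu>\<close>.\<close>
    have "measure_pmf.expectation \<nu> (\<lambda>s. h (- 1 - (y + s))) \<le> h (- 1 - y)" if "y < 0" for y
      using super[of "- 1 - y"] that by (simp add: E_nonneg diff_diff_eq)
    from ladder_window[where h = "\<lambda>y. h (- 1 - y)", OF h this, of x R] show ?thesis
      unfolding b_def by (simp add: E_nonneg algebra_simps cong: if_cong)
  qed
  have key: "h 0 - measure_pmf.expectation (osc_step \<mu> \<mu>' 0) h \<le> a R * (\<Sum>k<R. b k) + b R * (\<Sum>k<R. a k)" if "0 < R" for R
    using one_sided_window[of a b "\<lambda>y. h (int y)" "\<lambda>y. h (- 1 - int y)" R
        "\<lambda>x. measure_pmf.expectation (osc_step \<mu> \<mu>' (int x)) h"
        "\<lambda>x. measure_pmf.expectation (osc_step \<mu> \<mu>' (- 1 - int x)) h"] Kf Kg super h that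
    by (simp add: a_def b_def decseq_ladder_tail_prob ladder_tail_prob_nonneg)
  have a_lim: "(\<lambda>k. real k powr p * a k) \<longlonglongrightarrow> 0"
    using upward_ladder_decay[OF up(1) gcd(1) pq(1)] by (simp add: a_def ladder_tail_prob_def)
  have b_lim: "(\<lambda>k. real k powr q * b k) \<longlonglongrightarrow> 0"
    using upward_ladder_decay[of q \<nu>] up(2) gcd' pq(2) by (simp add: b_def \<nu>_def ladder_tail_prob_def)
  have "(\<lambda>R. a R * (\<Sum>k<R. b k) + b R * (\<Sum>k<R. a k)) \<longlonglongrightarrow> 0 + 0"
    using pq a_lim b_lim
    by (intro tendsto_add tail_product_tendsto_0[of p q] tail_product_tendsto_0[of q p])
      (auto simp: a_def b_def decseq_ladder_tail_prob ladder_tail_prob_nonneg)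
  then have "h 0 - measure_pmf.expectation (osc_step \<mu> \<mu>' 0) h \<le> 0 + 0"
    by (rule tendsto_lowerbound) (use key in \<open>auto simp: eventually_sequentially intro!: exI[of _ 1]\<close>)
  then show ?thesis by simp
qed

section \<open>Law of the oscillating walk\<close>

primrec osc_pmf :: "int pmf \<Rightarrow> int pmf \<Rightarrow> nat \<Rightarrow> int \<Rightarrow> int pmf" where
  "osc_pmf \<mu> \<mu>' 0 x = return_pmf x"
| "osc_pmf \<mu> \<mu>' (Suc n) x = bind_pmf (osc_pmf \<mu> \<mu>' n x) (osc_step \<mu> \<mu>')"

lemma osc_walk_measurable:
  assumes "\<And>i. 1 \<le> i \<Longrightarrow> i \<le> n \<Longrightarrow> \<xi> i \<in> measurable N (count_space UNIV)"
    and "\<And>i. 1 \<le> i \<Longrightarrow> i \<le> n \<Longrightarrow> \<xi>' i \<in> measurable N (count_space UNIV)"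
  shows "osc_walk \<xi> \<xi>' x n \<in> measurable N (count_space UNIV)"
  using assms
proof (induction n)
  case (Suc n)
  have [measurable]: "osc_walk \<xi> \<xi>' x n \<in> measurable N (count_space UNIV)"
    by (rule Suc.IH) (use Suc.prems in auto)
  have [measurable]: "\<xi> (Suc n) \<in> measurable N (count_space UNIV)" "\<xi>' (Suc n) \<in> measurable N (count_space UNIV)"
    using Suc.prems by auto
  have "osc_walk \<xi> \<xi>' x (Suc n) = (\<lambda>\<omega>. if osc_walk \<xi> \<xi>' x n \<omega> \<le> - 1
      then osc_walk \<xi> \<xi>' x n \<omega> + \<xi> (Suc n) \<omega> else osc_walk \<xi> \<xi>' x n \<omega> + \<xi>' (Suc n) \<omega>)"
    by (rule ext) simp
  then show ?case by simp
next
  case 0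
  have "osc_walk \<xi> \<xi>' x 0 = (\<lambda>\<omega>. x)" by (rule ext) simp
  then show ?case by simp
qed

lemma driving_sequenceD:
  assumes "driving_sequence M \<mu> \<mu>' \<xi> \<xi>'"
  shows "prob_space M"
    and "prob_space.indep_vars M (\<lambda>_. count_space UNIV) (\<lambda>n \<omega>. (\<xi> n \<omega>, \<xi>' n \<omega>)) {1..}"
    and "1 \<le> n \<Longrightarrow> distr M (count_space UNIV) (\<xi> n) = measure_pmf \<mu>"
    and "1 \<le> n \<Longrightarrow> distr M (count_space UNIV) (\<xi>' n) = measure_pmf \<mu>'"
    and "1 \<le> n \<Longrightarrow> \<xi> n \<in> measurable M (count_space UNIV)"
    and "1 \<le> n \<Longrightarrow> \<xi>' n \<in> measurable M (count_space UNIV)"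
proof -
  show M: "prob_space M"
    and ind: "prob_space.indep_vars M (\<lambda>_. count_space UNIV) (\<lambda>n \<omega>. (\<xi> n \<omega>, \<xi>' n \<omega>)) {1..}"
    and "1 \<le> n \<Longrightarrow> distr M (count_space UNIV) (\<xi> n) = measure_pmf \<mu>"
    and "1 \<le> n \<Longrightarrow> distr M (count_space UNIV) (\<xi>' n) = measure_pmf \<mu>'"
    using assms by (auto simp: driving_sequence_def)
  have pair: "1 \<le> n \<Longrightarrow> (\<lambda>\<omega>. (\<xi> n \<omega>, \<xi>' n \<omega>)) \<in> measurable M (count_space UNIV)"
    using ind unfolding prob_space.indep_vars_def[OF M] by blast
  show "1 \<le> n \<Longrightarrow> \<xi> n \<in> measurable M (count_space UNIV)"
    using measurable_compose[OF pair, of fst "count_space UNIV"] by simp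
  show "1 \<le> n \<Longrightarrow> \<xi>' n \<in> measurable M (count_space UNIV)"
    using measurable_compose[OF pair, of snd "count_space UNIV"] by simp
qed

lemma walk_measurable:
  assumes "driving_sequence M \<mu> \<mu>' \<xi> \<xi>'"
  shows "osc_walk \<xi> \<xi>' x n \<in> measurable M (count_space UNIV)"
  by (intro osc_walk_measurable driving_sequenceD(5,6)[OF assms])

text \<open>The pair at time \<open>n + 1\<close> is independent of the past, and the current sign
  selects one of its coordinates. Only the marginal laws enter, so dependence within a pair is
  harmless. Time \<open>0\<close> is left out of the constraint so that a walk started at
  \<open>0\<close> can be asked to avoid \<open>0\<close> afterwards.\<close>

lemma osc_walk_markov:
  fixes \<psi> :: "int \<Rightarrow> ennreal"
  assumes ds: "driving_sequence M \<mu> \<mu>' \<xi> \<xi>'"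
  shows "(\<integral>\<^sup>+\<omega>. indicator {\<omega>. \<forall>k\<in>{1..n}. osc_walk \<xi> \<xi>' x k \<omega> \<in> A} \<omega> * \<psi> (osc_walk \<xi> \<xi>' x (Suc n) \<omega>) \<partial>M)
    = (\<integral>\<^sup>+\<omega>. indicator {\<omega>. \<forall>k\<in>{1..n}. osc_walk \<xi> \<xi>' x k \<omega> \<in> A} \<omega>
         * (\<integral>\<^sup>+z. \<psi> z \<partial>measure_pmf (osc_step \<mu> \<mu>' (osc_walk \<xi> \<xi>' x n \<omega>))) \<partial>M)"
proof -
  interpret prob_space M by (rule driving_sequenceD(1)[OF ds])
  define P where "P i \<omega> = (\<xi> i \<omega>, \<xi>' i \<omega>)" for i \<omega>
  \<comment> \<open>The past as a function of the first \<open>n\<close> pairs. The event is coded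
    by \<open>0\<close> and \<open>1\<close> so that all values lie in a countable type, on which
    the product sigma-algebra is discrete.\<close>
  define G where "G w = (if \<forall>k\<in>{1..n}. osc_walk (\<lambda>i w. fst (w i)) (\<lambda>i w. snd (w i)) x k w \<in> A then 1 else 0 :: int,
      osc_walk (\<lambda>i w. fst (w i)) (\<lambda>i w. snd (w i)) x n w)" for w :: "nat \<Rightarrow> int \<times> int"
  define H where "H \<omega> = (if \<forall>k\<in>{1..n}. osc_walk \<xi> \<xi>' x k \<omega> \<in> A then 1 else 0 :: int, osc_walk \<xi> \<xi>' x n \<omega>)" for \<omega>
  define F where "F h s = (indicator {1} (fst h) :: ennreal) * \<psi> (if snd h \<le> - 1 then snd h + fst s else snd h + snd s)"
    for h :: "int \<times> int" and s :: "int \<times> int"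
  let ?C = "count_space UNIV"
  have comp[measurable]: "(\<lambda>w. w i) \<in> measurable (PiM {1..n} (\<lambda>_. ?C :: (int \<times> int) measure)) ?C" if "1 \<le> i" "i \<le> n" for i
    using that by (intro measurable_component_singleton) auto
  have walk_G[measurable]: "osc_walk (\<lambda>i w. fst (w i)) (\<lambda>i w. snd (w i)) x k
      \<in> measurable (PiM {1..n} (\<lambda>_. ?C :: (int \<times> int) measure)) ?C" if "k \<le> n" for k
    using that
    by (intro osc_walk_measurable measurable_compose[OF comp, of _ fst ?C] measurable_compose[OF comp, of _ snd ?C]) auto
  have pred_G: "(\<lambda>w. \<forall>k\<in>{1..n}. osc_walk (\<lambda>i w. fst (w i)) (\<lambda>i w. snd (w i)) x k w \<in> A)
      \<in> measurable (PiM {1..n} (\<lambda>_. ?C :: (int \<times> int) measure)) ?C"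
    by (intro pred_intros_finite measurable_compose[OF walk_G, of _ "\<lambda>y. y \<in> A" ?C]) auto
  have G_meas: "G \<in> measurable (PiM {1..n} (\<lambda>_. ?C)) ?C"
  proof -
    have "G \<in> measurable (PiM {1..n} (\<lambda>_. ?C)) (?C \<Otimes>\<^sub>M ?C)"
      unfolding G_def
      by (rule measurable_Pair[OF measurable_compose[OF pred_G, of "\<lambda>b. if b then 1 else 0"] walk_G]) simp_all
    then show ?thesis by (simp add: pair_measure_countable)
  qed
  have "indep_var ?C (G \<circ> (\<lambda>\<omega>. restrict (\<lambda>i. P i \<omega>) {1..n}))
      ?C ((\<lambda>w. w (Suc n)) \<circ> (\<lambda>\<omega>. restrict (\<lambda>i. P i \<omega>) {Suc n}))"
  proof (rule indep_var_compose[OF indep_var_restrict G_meas measurable_component_singleton])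
    show "indep_vars (\<lambda>_. ?C) P {1..}"
      using driving_sequenceD(2)[OF ds] by (simp add: P_def[abs_def])
  qed auto
  moreover have "G \<circ> (\<lambda>\<omega>. restrict (\<lambda>i. P i \<omega>) {1..n}) = H"
  proof
    fix \<omega>
    have "osc_walk (\<lambda>i w. fst (w i)) (\<lambda>i w. snd (w i)) x k (restrict (\<lambda>i. P i \<omega>) {1..n}) = osc_walk \<xi> \<xi>' x k \<omega>"
      if "k \<le> n" for k
      using that by (induction k) (simp_all add: P_def)
    then show "(G \<circ> (\<lambda>\<omega>. restrict (\<lambda>i. P i \<omega>) {1..n})) \<omega> = H \<omega>"
      by (auto simp: G_def H_def)
  qed
  moreover have "(\<lambda>w. w (Suc n)) \<circ> (\<lambda>\<omega>. restrict (\<lambda>i. P i \<omega>) {Suc n}) = P (Suc n)"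
    by auto
  ultimately have ind: "indep_var ?C H ?C (P (Suc n))" by simp
  have [measurable]: "H \<in> measurable M ?C" "P (Suc n) \<in> measurable M ?C"
    using ind by (auto simp: indep_var_eq)
  let ?D = "distr M ?C (P (Suc n))"
  interpret D: prob_space ?D by (rule prob_space_distr) simp
  have joint: "distr M ?C (\<lambda>\<omega>. (H \<omega>, P (Suc n) \<omega>)) = distr M ?C H \<Otimes>\<^sub>M ?D"
  proof -
    have "distr M ?C H \<Otimes>\<^sub>M ?D = distr M (?C \<Otimes>\<^sub>M ?C) (\<lambda>\<omega>. (H \<omega>, P (Suc n) \<omega>))"
      using ind by (simp add: indep_var_distribution_eq)
    then show ?thesis by (simp add: pair_measure_countable)
  qed
  have HP: "(\<lambda>\<omega>. (H \<omega>, P (Suc n) \<omega>)) \<in> measurable M ?C"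
  proof -
    have "(\<lambda>\<omega>. (H \<omega>, P (Suc n) \<omega>)) \<in> measurable M (?C \<Otimes>\<^sub>M ?C)" by measurable
    then show ?thesis by (simp add: pair_measure_countable)
  qed
  have F_meas: "case_prod F \<in> borel_measurable (distr M ?C H \<Otimes>\<^sub>M ?D)"
    by (subst joint[symmetric]) simp
  have inner: "(\<integral>\<^sup>+s. F h s \<partial>?D) = indicator {1} (fst h) * (\<integral>\<^sup>+z. \<psi> z \<partial>measure_pmf (osc_step \<mu> \<mu>' (snd h)))" for h
  proof -
    have "(\<integral>\<^sup>+s. F h s \<partial>?D) = (\<integral>\<^sup>+\<omega>. F h (P (Suc n) \<omega>) \<partial>M)"
      by (rule nn_integral_distr) simp_all
    also have "\<dots> = indicator {1} (fst h) *
        (\<integral>\<^sup>+\<omega>. \<psi> (if snd h \<le> - 1 then snd h + \<xi> (Suc n) \<omega> else snd h + \<xi>' (Suc n) \<omega>) \<partial>M)"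
    proof -
      have [measurable]: "\<xi> (Suc n) \<in> measurable M ?C" "\<xi>' (Suc n) \<in> measurable M ?C"
        by (rule driving_sequenceD[OF ds], simp)+
      show ?thesis
        unfolding F_def P_def fst_conv snd_conv by (rule nn_integral_cmult) measurable
    qed
    also have "(\<integral>\<^sup>+\<omega>. \<psi> (if snd h \<le> - 1 then snd h + \<xi> (Suc n) \<omega> else snd h + \<xi>' (Suc n) \<omega>) \<partial>M)
       = (\<integral>\<^sup>+z. \<psi> z \<partial>measure_pmf (osc_step \<mu> \<mu>' (snd h)))"
    proof (cases "snd h \<le> - 1")
      case True
      have "(\<integral>\<^sup>+\<omega>. \<psi> (snd h + \<xi> (Suc n) \<omega>) \<partial>M) = (\<integral>\<^sup>+s. \<psi> (snd h + s) \<partial>distr M ?C (\<xi> (Suc n)))"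
        by (rule nn_integral_distr[symmetric]) (use driving_sequenceD(5)[OF ds, of "Suc n"] in auto)
      then show ?thesis using True driving_sequenceD(3)[OF ds, of "Suc n"] by (simp add: osc_step_def)
    next
      case False
      have "(\<integral>\<^sup>+\<omega>. \<psi> (snd h + \<xi>' (Suc n) \<omega>) \<partial>M) = (\<integral>\<^sup>+s. \<psi> (snd h + s) \<partial>distr M ?C (\<xi>' (Suc n)))"
        by (rule nn_integral_distr[symmetric]) (use driving_sequenceD(6)[OF ds, of "Suc n"] in auto)
      then show ?thesis using False driving_sequenceD(4)[OF ds, of "Suc n"] by (simp add: osc_step_def)
    qed
    finally show ?thesis .
  qed
  have "(\<integral>\<^sup>+\<omega>. indicator {\<omega>. \<forall>k\<in>{1..n}. osc_walk \<xi> \<xi>' x k \<omega> \<in> A} \<omega> * \<psi> (osc_walk \<xi> \<xi>' x (Suc n) \<omega>) \<partial>M)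
     = (\<integral>\<^sup>+\<omega>. case_prod F (H \<omega>, P (Suc n) \<omega>) \<partial>M)"
    by (intro nn_integral_cong) (simp add: F_def H_def P_def indicator_def)
  also have "\<dots> = (\<integral>\<^sup>+hs. case_prod F hs \<partial>distr M ?C (\<lambda>\<omega>. (H \<omega>, P (Suc n) \<omega>)))"
    by (rule nn_integral_distr[symmetric]) (simp_all add: HP)
  also have "\<dots> = (\<integral>\<^sup>+h. \<integral>\<^sup>+s. F h s \<partial>?D \<partial>distr M ?C H)"
    unfolding joint by (subst D.nn_integral_fst[symmetric, OF F_meas]) simp
  also have "\<dots> = (\<integral>\<^sup>+\<omega>. \<integral>\<^sup>+s. F (H \<omega>) s \<partial>?D \<partial>M)"
    by (rule nn_integral_distr) simp_all
  also have "\<dots> = (\<integral>\<^sup>+\<omega>. indicator {\<omega>. \<forall>k\<in>{1..n}. osc_walk \<xi> \<xi>' x k \<omega> \<in> A} \<omega>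
         * (\<integral>\<^sup>+z. \<psi> z \<partial>measure_pmf (osc_step \<mu> \<mu>' (osc_walk \<xi> \<xi>' x n \<omega>))) \<partial>M)"
    unfolding inner by (intro nn_integral_cong) (simp add: H_def indicator_def)
  finally show ?thesis .
qed

lemma distr_osc_walk:
  assumes ds: "driving_sequence M \<mu> \<mu>' \<xi> \<xi>'"
  shows "distr M (count_space UNIV) (osc_walk \<xi> \<xi>' x n) = measure_pmf (osc_pmf \<mu> \<mu>' n x)"
proof (induction n)
  case 0
  interpret prob_space M by (rule driving_sequenceD(1)[OF ds])
  show ?case
    by (rule measure_eqI_countable[of _ UNIV]) (auto simp: emeasure_distr emeasure_space_1 indicator_def emeasure_pmf_single)
next
  case (Suc n)
  note [measurable] = walk_measurable[OF ds]
  show ?case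
  proof (rule measure_eqI_countable[of _ UNIV])
    fix z
    have "emeasure (distr M (count_space UNIV) (osc_walk \<xi> \<xi>' x (Suc n))) {z}
       = (\<integral>\<^sup>+y. indicator {z} y \<partial>distr M (count_space UNIV) (osc_walk \<xi> \<xi>' x (Suc n)))"
      by simp
    also have "\<dots> = (\<integral>\<^sup>+\<omega>. indicator {z} (osc_walk \<xi> \<xi>' x (Suc n) \<omega>) \<partial>M)"
      by (rule nn_integral_distr) (simp_all add: walk_measurable[OF ds])
    also have "\<dots> = (\<integral>\<^sup>+\<omega>. \<integral>\<^sup>+y. indicator {z} y \<partial>measure_pmf (osc_step \<mu> \<mu>' (osc_walk \<xi> \<xi>' x n \<omega>)) \<partial>M)"
      using osc_walk_markov[OF ds, where A = UNIV and n = n and x = x and \<psi> = "indicator {z}"] by simp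
    also have "\<dots> = (\<integral>\<^sup>+y. \<integral>\<^sup>+y. indicator {z} y \<partial>measure_pmf (osc_step \<mu> \<mu>' y) \<partial>distr M (count_space UNIV) (osc_walk \<xi> \<xi>' x n))"
      by (rule nn_integral_distr[symmetric]) (simp_all add: walk_measurable[OF ds])
    also have "\<dots> = emeasure (osc_pmf \<mu> \<mu>' (Suc n) x) {z}"
      unfolding Suc.IH by (simp add: emeasure_pmf_single ennreal_pmf_bind)
    finally show "emeasure (distr M (count_space UNIV) (osc_walk \<xi> \<xi>' x (Suc n))) {z} = emeasure (osc_pmf \<mu> \<mu>' (Suc n) x) {z}" .
  qed auto
qed

text \<open>Reduces communication of states to the combinatorics of the supports: a state has
  positive mass at time \<open>n\<close> exactly if a chain of \<open>n\<close> possible steps leads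
  to it.\<close>

lemma accessible_iff:
  assumes ds: "driving_sequence M \<mu> \<mu>' \<xi> \<xi>'"
  shows "accessible M \<xi> \<xi>' x y \<longleftrightarrow> (\<lambda>u v. v \<in> set_pmf (osc_step \<mu> \<mu>' u))\<^sup>*\<^sup>* x y"
proof -
  let ?r = "\<lambda>u v. v \<in> set_pmf (osc_step \<mu> \<mu>' u)"
  have pos: "measure M {\<omega> \<in> space M. osc_walk \<xi> \<xi>' x n \<omega> = y} = pmf (osc_pmf \<mu> \<mu>' n x) y" for n y
  proof -
    have "measure M {\<omega> \<in> space M. osc_walk \<xi> \<xi>' x n \<omega> = y} = measure (distr M (count_space UNIV) (osc_walk \<xi> \<xi>' x n)) {y}"
      by (subst measure_distr) (auto simp: walk_measurable[OF ds] intro!: arg_cong2[where f = measure])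
    then show ?thesis by (simp add: distr_osc_walk[OF ds] measure_pmf_single)
  qed
  have "y \<in> set_pmf (osc_pmf \<mu> \<mu>' n x) \<longleftrightarrow> (?r ^^ n) x y" for n y
    by (induction n arbitrary: y) auto
  then show ?thesis
    by (simp add: accessible_def pos pmf_positive_iff rtranclp_power)
qed

section \<open>The state 0 is reached from everywhere\<close>

text \<open>Division with remainder by the least positive element of \<open>Z\<close> shows that
  this element divides all of \<open>S\<close>, hence its gcd.\<close>

lemma one_in_int_subgroup:
  fixes Z S :: "int set"
  assumes Z: "0 \<in> Z" "\<And>x y. x \<in> Z \<Longrightarrow> y \<in> Z \<Longrightarrow> x - y \<in> Z" and "S \<subseteq> Z" and gcd: "Gcd S = 1"
  shows "1 \<in> Z"
proof -
  have neg: "- x \<in> Z" if "x \<in> Z" for x using Z(2)[OF Z(1) that] by simp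
  have add: "x + y \<in> Z" if "x \<in> Z" "y \<in> Z" for x y using Z(2)[OF that(1) neg[OF that(2)]] by simp
  have nat_mult: "int n * x \<in> Z" if "x \<in> Z" for n x
    by (induction n) (use Z(1) add[OF that] in \<open>auto simp: distrib_right\<close>)
  have mult: "k * x \<in> Z" if "x \<in> Z" for k x
    using nat_mult[OF that, of "nat \<bar>k\<bar>"] neg[OF nat_mult[OF that, of "nat \<bar>k\<bar>"]] by (cases "0 \<le> k") auto
  have "\<not> S \<subseteq> {0}"
  proof
    assume "S \<subseteq> {0}"
    then have "Gcd S = 0" by simp
    with gcd show False by simp
  qed
  then obtain s where s: "s \<in> S" "s \<noteq> 0" by auto
  define e where "e = (LEAST n. 0 < n \<and> int n \<in> Z)"
  have ex: "0 < nat \<bar>s\<bar> \<and> int (nat \<bar>s\<bar>) \<in> Z"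
    using s \<open>S \<subseteq> Z\<close> neg by (auto simp: abs_if)
  have e: "0 < e \<and> int e \<in> Z"
    unfolding e_def by (rule LeastI[where P = "\<lambda>n. 0 < n \<and> int n \<in> Z", OF ex])
  have "int e dvd t" if "t \<in> S" for t
  proof -
    have "t mod int e \<in> Z"
      using Z(2)[of t "t div int e * int e"] that \<open>S \<subseteq> Z\<close> mult e by (auto simp: minus_div_mult_eq_mod)
    moreover have "0 \<le> t mod int e" "t mod int e < int e" using e by simp_all
    ultimately have "t mod int e = 0"
      using not_less_Least[where P = "\<lambda>n. 0 < n \<and> int n \<in> Z" and k = "nat (t mod int e)"]
      unfolding e_def[symmetric] by auto
    then show ?thesis by (simp add: dvd_eq_mod_eq_0)
  qed
  then have "int e dvd Gcd S" by (rule Gcd_greatest)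
  then have "int e = 1" using gcd by simp
  then show ?thesis using e by simp
qed

text \<open>
  Using only the jumps \<open>b\<close> and \<open>- d\<close>, the walk in \<open>[- d, b[\<close> is the rotation by \<open>b\<close> modulo \<open>b + d\<close>, so it
  connects states that agree modulo \<open>gcd b d\<close>. The residue changes that the jumps of \<open>\<mu>\<close> allow form a subgroup.
\<close>

lemma osc_step_reaches_0:
  fixes \<mu> \<mu>' :: "int pmf"
  assumes gcd: "Gcd (set_pmf \<mu>) = 1"
    and b: "b \<in> set_pmf \<mu>" "0 < b" and d: "- d \<in> set_pmf \<mu>'" "0 < d"
  shows "(\<lambda>u v. v \<in> set_pmf (osc_step \<mu> \<mu>' u))\<^sup>*\<^sup>* x 0"
proof -
  let ?r = "\<lambda>u v. v \<in> set_pmf (osc_step \<mu> \<mu>' u)"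
  define g where "g = gcd b d"
  have g: "g dvd b" "g dvd d" "0 < g" using b by (simp_all add: g_def)
  have up: "?r u (u + s)" if "u < 0" "s \<in> set_pmf \<mu>" for u s
    using that by (simp add: osc_step_def)
  have down: "?r u (u - d)" if "0 \<le> u" for u
    using that d(1) by (auto simp: osc_step_def intro!: image_eqI[of _ _ "- d"])
  \<comment> \<open>Outside the window the available jump points towards it. As long as it does not
    change the sign class it decreases the absolute value; once it does, it lands in the
    window.\<close>
  have into: "\<exists>y. ?r\<^sup>*\<^sup>* x y \<and> - d \<le> y \<and> y < b \<and> g dvd (y - x)" for x
  proof (induction x rule: measure_induct_rule[where f = "\<lambda>x. nat \<bar>x\<bar>"])
    case (less x)
    consider "x < - d" "x + b < 0" | "x < - d" "0 \<le> x + b" | "- d \<le> x" "x < b" | "b \<le> x" "0 \<le> x - d" | "b \<le> x" "x - d < 0"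
      by linarith
    then show ?case
    proof cases
      case 1
      then obtain y where y: "?r\<^sup>*\<^sup>* (x + b) y" "- d \<le> y" "y < b" "g dvd (y - (x + b))"
        using less[of "x + b"] b by auto
      moreover have "?r x (x + b)" using 1 b d by (intro up) auto
      moreover have "g dvd (y - x)" using dvd_add[OF y(4) g(1)] by simp
      ultimately show ?thesis by (meson converse_rtranclp_into_rtranclp)
    next
      case 2
      then show ?thesis using up[of x b] b d g by (intro exI[of _ "x + b"]) auto
    next
      case 3
      then show ?thesis by (intro exI[of _ x]) auto
    next
      case 4
      then obtain y where y: "?r\<^sup>*\<^sup>* (x - d) y" "- d \<le> y" "y < b" "g dvd (y - (x - d))"
        using less[of "x - d"] b d by auto
      moreover have "?r x (x - d)" using 4 b d by (intro down) auto
      moreover have "g dvd (y - x)" using dvd_diff[OF y(4) g(2)] by simp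
      ultimately show ?thesis by (meson converse_rtranclp_into_rtranclp)
    next
      case 5
      then show ?thesis using down[of x] b d g by (intro exI[of _ "x - d"]) auto
    qed
  qed
  have rotate: "\<exists>z. ?r\<^sup>*\<^sup>* x z \<and> - d \<le> z \<and> z < b \<and> [z = x + int n * b] (mod (b + d))"
    if "- d \<le> x" "x < b" for x n
  proof (induction n)
    case 0
    then show ?case using that by (intro exI[of _ x]) auto
  next
    case (Suc n)
    then obtain z where z: "?r\<^sup>*\<^sup>* x z" "- d \<le> z" "z < b" "[z = x + int n * b] (mod (b + d))" by blast
    have plus: "[z + b = x + int (Suc n) * b] (mod (b + d))"
      using cong_add[OF z(4) cong_refl[of b]] by (simp add: algebra_simps)
    show ?case
    proof (cases "z < 0")
      case True
      then have "?r\<^sup>*\<^sup>* x (z + b)" using z(1) up[of z b] b by (meson rtranclp.rtrancl_into_rtrancl)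
      then show ?thesis using True z b d plus by (intro exI[of _ "z + b"]) auto
    next
      case False
      then have "?r\<^sup>*\<^sup>* x (z - d)" using z(1) down[of z] by (meson not_less rtranclp.rtrancl_into_rtrancl)
      moreover have "[z - d = z + b] (mod (b + d))"
        unfolding cong_iff_dvd_diff by (rule dvdI[of _ _ "- 1"]) simp
      ultimately show ?thesis using False z b d cong_trans[OF _ plus] by (intro exI[of _ "z - d"]) auto
    qed
  qed
  have within: "?r\<^sup>*\<^sup>* x y" if xy: "- d \<le> x" "x < b" "- d \<le> y" "y < b" "g dvd (y - x)" for x y
  proof -
    have "gcd b (b + d) dvd (y - x)" using xy(5) by (simp add: g_def)
    then obtain k where k: "y - x = gcd b (b + d) * k" by (elim dvdE)
    obtain u v where uv: "u * b + v * (b + d) = gcd b (b + d)" using bezout_int by blast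
    \<comment> \<open>The number of rotations: \<open>u * k\<close> solves the congruence by Bezout,
      and its residue is a nonnegative count.\<close>
    define n where "n = nat ((u * k) mod (b + d))"
    have n: "int n = (u * k) mod (b + d)" using b d by (simp add: n_def)
    have "[int n * b = u * k * b] (mod (b + d))"
      unfolding n by (intro cong_mult cong_refl) (simp add: cong_def)
    also have "[u * k * b = y - x] (mod (b + d))"
    proof -
      have "u * k * b - (y - x) = (b + d) * (- v * k)"
        unfolding k uv[symmetric] by (simp add: algebra_simps)
      then show ?thesis unfolding cong_iff_dvd_diff by (rule dvdI)
    qed
    finally have n_cong: "[x + int n * b = y] (mod (b + d))"
      using cong_add[OF cong_refl[of x], of "int n * b" "y - x"] by simp
    obtain z where z: "?r\<^sup>*\<^sup>* x z" "- d \<le> z" "z < b" "[z = x + int n * b] (mod (b + d))"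
      using rotate[OF xy(1,2)] by blast
    have "(b + d) dvd (z - y)" using cong_trans[OF z(4) n_cong] by (simp add: cong_iff_dvd_diff)
    moreover have "\<bar>z - y\<bar> < \<bar>b + d\<bar>" using z xy b d by auto
    ultimately have "z = y" using dvd_imp_le_int[of "z - y" "b + d"] by auto
    then show ?thesis using z by simp
  qed
  \<comment> \<open>The residue changes modulo \<open>g\<close> that can be realised from every
    start. The quantifier over all starts is what makes changes composable.\<close>
  define Z where "Z = {z. \<forall>x. \<exists>y. ?r\<^sup>*\<^sup>* x y \<and> g dvd (y - x - z)}"
  have Z_add: "z + z' \<in> Z" if zz: "z \<in> Z" "z' \<in> Z" for z z'
  proof -
    have "\<exists>y. ?r\<^sup>*\<^sup>* x y \<and> g dvd (y - x - (z + z'))" for x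
    proof -
      obtain y where y: "?r\<^sup>*\<^sup>* x y" "g dvd (y - x - z)" using zz by (auto simp: Z_def)
      obtain y' where y': "?r\<^sup>*\<^sup>* y y'" "g dvd (y' - y - z')" using zz by (auto simp: Z_def)
      have "y - x - z + (y' - y - z') = y' - x - (z + z')" by simp
      then show ?thesis using rtranclp_trans[OF y(1) y'(1)] dvd_add[OF y(2) y'(2)] by metis
    qed
    then show ?thesis by (simp add: Z_def)
  qed
  have Z_g: "z \<in> Z" if "g dvd z" for z
    unfolding Z_def using that by (auto intro!: exI[where P = "\<lambda>y. ?r\<^sup>*\<^sup>* _ y \<and> g dvd (y - _ - z)"])
  have Z_nat: "int n * z \<in> Z" if "z \<in> Z" for n z
    by (induction n) (use Z_g[of 0] Z_add[OF that] in \<open>auto simp: distrib_right\<close>)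
  have Z_minus: "- z \<in> Z" if "z \<in> Z" for z
  proof -
    \<comment> \<open>Repeating \<open>z\<close> another \<open>g - 1\<close> times has the effect
      of \<open>- z\<close> modulo \<open>g\<close>.\<close>
    have "int (nat (g - 1)) * z + - (g * z) \<in> Z" by (intro Z_add Z_nat that Z_g) simp
    then show ?thesis using g by (simp add: algebra_simps)
  qed
  have "1 \<in> Z"
  proof (rule one_in_int_subgroup[OF _ _ _ gcd])
    show "set_pmf \<mu> \<subseteq> Z"
    proof
      fix s assume s: "s \<in> set_pmf \<mu>"
      have "\<exists>y. ?r\<^sup>*\<^sup>* x y \<and> g dvd (y - x - s)" for x
      proof -
        obtain y where y: "?r\<^sup>*\<^sup>* x y" "- d \<le> y" "y < b" "g dvd (y - x)" using into by blast
        \<comment> \<open>The representative of \<open>y\<close> modulo \<open>d\<close> in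
          \<open>[- d, 0[\<close>: a negative state in the right class, from which a step of
          \<open>\<mu>\<close> is allowed.\<close>
        define x' where "x' = - 1 - (- 1 - y) mod d"
        have x': "- d \<le> x'" "x' < 0"
          unfolding x'_def
          using pos_mod_bound[OF d(2), of "- 1 - y"] pos_mod_sign[OF d(2), of "- 1 - y"] by linarith+
        have "d dvd (x' - y)"
          using dvd_minus_mod[of d "- 1 - y"] unfolding x'_def by (simp add: algebra_simps)
        then have *: "g dvd (x' - y)" using g dvd_trans by blast
        then have "?r\<^sup>*\<^sup>* y x'" using y x' b by (intro within) auto
        then have "?r\<^sup>*\<^sup>* x (x' + s)" using y(1) up[OF x'(2) s] by (meson rtranclp_trans rtranclp.rtrancl_into_rtrancl)
        moreover have "g dvd (x' + s - x - s)" using dvd_add[OF * y(4)] by simp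
        ultimately show ?thesis by blast
      qed
      then show "s \<in> Z" by (simp add: Z_def)
    qed
  qed (use Z_g[of 0] Z_add Z_minus in \<open>auto simp del: add_uminus_conv_diff simp: diff_conv_add_uminus\<close>)
  have "- x \<in> Z"
    using Z_nat[OF \<open>1 \<in> Z\<close>, of "nat \<bar>x\<bar>"] Z_minus[OF Z_nat[OF \<open>1 \<in> Z\<close>, of "nat \<bar>x\<bar>"]] by (cases "0 \<le> x") auto
  then obtain y where y: "?r\<^sup>*\<^sup>* x y" "g dvd y" unfolding Z_def by force
  obtain y' where y': "?r\<^sup>*\<^sup>* y y'" "- d \<le> y'" "y' < b" "g dvd (y' - y)" using into by blast
  have "g dvd (0 - y')" using dvd_add[OF y'(4) y(2)] by simp
  then have "?r\<^sup>*\<^sup>* y' 0" using y' b d by (intro within) auto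
  then show ?thesis using y(1) y'(1) by (meson rtranclp_trans)
qed

section \<open>Recurrence\<close>

text \<open>Finite horizons make \<open>h\<close> an increasing limit, so that its superharmonicity
  follows by dominated convergence without events on path space.\<close>

primrec hit_prob :: "int pmf \<Rightarrow> int pmf \<Rightarrow> nat \<Rightarrow> int \<Rightarrow> real" where
  "hit_prob \<mu> \<mu>' 0 x = (if x = 0 then 1 else 0)"
| "hit_prob \<mu> \<mu>' (Suc n) x
    = (if x = 0 then 1 else measure_pmf.expectation (osc_step \<mu> \<mu>' x) (hit_prob \<mu> \<mu>' n))"

lemma integrable_pmf_unit:
  fixes f :: "int \<Rightarrow> real"
  assumes "\<And>x. 0 \<le> f x" "\<And>x. f x \<le> 1"
  shows "integrable (measure_pmf \<rho>) f"
  using assms by (intro measure_pmf.integrable_const_bound[where B = 1]) auto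

lemma hit_prob_bounds: "0 \<le> hit_prob \<mu> \<mu>' n x \<and> hit_prob \<mu> \<mu>' n x \<le> 1"
proof (induction n arbitrary: x)
  case (Suc n)
  have "measure_pmf.expectation (osc_step \<mu> \<mu>' x) (hit_prob \<mu> \<mu>' n) \<le> measure_pmf.expectation (osc_step \<mu> \<mu>' x) (\<lambda>_. 1)"
    using Suc.IH by (intro integral_mono integrable_pmf_unit) auto
  moreover have "0 \<le> measure_pmf.expectation (osc_step \<mu> \<mu>' x) (hit_prob \<mu> \<mu>' n)"
    using Suc.IH by (intro integral_nonneg_AE) auto
  ultimately show ?case by simp
qed simp

lemma hit_prob_at_0 [simp]: "hit_prob \<mu> \<mu>' n 0 = 1"
  by (cases n) simp_all

lemma incseq_hit_prob: "incseq (\<lambda>n. hit_prob \<mu> \<mu>' n x)"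
proof (rule incseq_SucI)
  fix n show "hit_prob \<mu> \<mu>' n x \<le> hit_prob \<mu> \<mu>' (Suc n) x"
  proof (induction n arbitrary: x)
    case 0
    show ?case using hit_prob_bounds[of \<mu> \<mu>' 1 x] by (cases "x = 0") simp_all
  next
    case (Suc n)
    have "measure_pmf.expectation (osc_step \<mu> \<mu>' x) (hit_prob \<mu> \<mu>' n)
        \<le> measure_pmf.expectation (osc_step \<mu> \<mu>' x) (hit_prob \<mu> \<mu>' (Suc n))"
      by (intro integral_mono integrable_pmf_unit Suc.IH) (use hit_prob_bounds in \<open>auto simp del: hit_prob.simps\<close>)
    then show ?case by simp
  qed
qed

lemma return_prob_tendsto_1:
  assumes up: "upward p \<mu>" "upward q (map_pmf uminus \<mu>')"
    and gcd: "Gcd (set_pmf \<mu>) = 1" "Gcd (set_pmf \<mu>') = 1"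
    and pq: "0 < p" "0 < q" "p + q = 1"
  shows "(\<lambda>n. measure_pmf.expectation (osc_step \<mu> \<mu>' 0) (hit_prob \<mu> \<mu>' n)) \<longlonglongrightarrow> 1"
proof -
  define h where "h x = lim (\<lambda>n. hit_prob \<mu> \<mu>' n x)" for x
  have h_lim: "(\<lambda>n. hit_prob \<mu> \<mu>' n x) \<longlonglongrightarrow> h x" for x
  proof -
    have "convergent (\<lambda>n. hit_prob \<mu> \<mu>' n x)"
      using incseq_hit_prob hit_prob_bounds by (intro Bseq_mono_convergent BseqI'[of _ 1]) (auto simp: incseq_def)
    then show ?thesis by (simp add: h_def convergent_LIMSEQ_iff)
  qed
  have h: "0 \<le> h x" "h x \<le> 1" for x
    using LIMSEQ_le_const[OF h_lim] LIMSEQ_le_const2[OF h_lim] hit_prob_bounds by blast+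
  have h_0: "h 0 = 1" using h_lim[of 0] by (simp add: LIMSEQ_const_iff)
  have E_lim: "(\<lambda>n. measure_pmf.expectation (osc_step \<mu> \<mu>' x) (hit_prob \<mu> \<mu>' n))
      \<longlonglongrightarrow> measure_pmf.expectation (osc_step \<mu> \<mu>' x) h" for x
    by (rule integral_dominated_convergence[where w = "\<lambda>_. 1"]) (use h_lim hit_prob_bounds in auto)
  \<comment> \<open>Away from \<open>0\<close> the limit of the recursion gives harmonicity; at
    \<open>0\<close> the inequality holds because \<open>h 0 = 1\<close> is the maximal
    value.\<close>
  have super: "measure_pmf.expectation (osc_step \<mu> \<mu>' x) h \<le> h x" for x
  proof (cases "x = 0")
    case True
    have "measure_pmf.expectation (osc_step \<mu> \<mu>' x) h \<le> measure_pmf.expectation (osc_step \<mu> \<mu>' x) (\<lambda>_. 1)"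
      using h by (intro integral_mono integrable_pmf_unit) auto
    then show ?thesis using True h_0 by simp
  next
    case False
    have "(\<lambda>n. hit_prob \<mu> \<mu>' (Suc n) x) \<longlonglongrightarrow> h x" using h_lim by (rule LIMSEQ_Suc)
    then have "(\<lambda>n. measure_pmf.expectation (osc_step \<mu> \<mu>' x) (hit_prob \<mu> \<mu>' n)) \<longlonglongrightarrow> h x"
      using False by simp
    then show ?thesis using LIMSEQ_unique[OF E_lim] by simp
  qed
  have "1 \<le> measure_pmf.expectation (osc_step \<mu> \<mu>' 0) h"
    using superharmonic_eq_at_0[OF up gcd pq h super] h_0 by simp
  then have "measure_pmf.expectation (osc_step \<mu> \<mu>' 0) h = 1" using super[of 0] h_0 by simp
  then show ?thesis using E_lim[of 0] by simp
qed

text \<open>Connects the analytic recursion with the paths: the Markov property trades one unit of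
  elapsed time for one unit of the remaining horizon.\<close>

lemma no_return_prob:
  assumes ds: "driving_sequence M \<mu> \<mu>' \<xi> \<xi>'"
  shows "emeasure M {\<omega> \<in> space M. \<forall>k\<in>{1..Suc r}. osc_walk \<xi> \<xi>' 0 k \<omega> \<noteq> 0}
    = ennreal (1 - measure_pmf.expectation (osc_step \<mu> \<mu>' 0) (hit_prob \<mu> \<mu>' r))"
proof -
  interpret prob_space M by (rule driving_sequenceD(1)[OF ds])
  note [measurable] = walk_measurable[OF ds]
  define N where "N m = {\<omega>. \<forall>k\<in>{1..m}. osc_walk \<xi> \<xi>' 0 k \<omega> \<in> - {0}}" for m
  define Z where "Z m \<phi> = (\<integral>\<^sup>+\<omega>. indicator (N m) \<omega> * \<phi> (osc_walk \<xi> \<xi>' 0 m \<omega>) \<partial>M)" for m and \<phi> :: "int \<Rightarrow> ennreal"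
  define \<phi> where "\<phi> n x = ennreal (1 - hit_prob \<mu> \<mu>' n x)" for n x
  have E: "(\<integral>\<^sup>+z. \<phi> n z \<partial>measure_pmf \<rho>) = ennreal (1 - measure_pmf.expectation \<rho> (hit_prob \<mu> \<mu>' n))" for n \<rho>
  proof -
    have "(\<integral>\<^sup>+z. \<phi> n z \<partial>measure_pmf \<rho>) = ennreal (measure_pmf.expectation \<rho> (\<lambda>z. 1 - hit_prob \<mu> \<mu>' n z))"
      unfolding \<phi>_def using hit_prob_bounds[of \<mu> \<mu>' n]
      by (intro nn_integral_eq_integral integrable_pmf_unit) auto
    also have "measure_pmf.expectation \<rho> (\<lambda>z. 1 - hit_prob \<mu> \<mu>' n z) = 1 - measure_pmf.expectation \<rho> (hit_prob \<mu> \<mu>' n)"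
      using hit_prob_bounds[of \<mu> \<mu>' n]
      by (subst Bochner_Integration.integral_diff) (auto intro!: integrable_pmf_unit)
    finally show ?thesis .
  qed
  have Z_Suc: "Z (Suc m) (\<phi> n) = (\<integral>\<^sup>+\<omega>. indicator (N m) \<omega>
      * ennreal (1 - measure_pmf.expectation (osc_step \<mu> \<mu>' (osc_walk \<xi> \<xi>' 0 m \<omega>)) (hit_prob \<mu> \<mu>' n)) \<partial>M)" for m n
  proof -
    have "Z (Suc m) (\<phi> n) = (\<integral>\<^sup>+\<omega>. indicator (N m) \<omega> * \<phi> n (osc_walk \<xi> \<xi>' 0 (Suc m) \<omega>) \<partial>M)"
      unfolding Z_def
    proof (intro nn_integral_cong)
      fix \<omega>
      have "\<omega> \<in> N (Suc m) \<longleftrightarrow> \<omega> \<in> N m \<and> osc_walk \<xi> \<xi>' 0 (Suc m) \<omega> \<noteq> 0"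
        by (auto simp: N_def atLeastAtMostSuc_conv simp del: osc_walk.simps)
      moreover have "\<phi> n 0 = 0" by (simp add: \<phi>_def)
      ultimately show "indicator (N (Suc m)) \<omega> * \<phi> n (osc_walk \<xi> \<xi>' 0 (Suc m) \<omega>)
          = indicator (N m) \<omega> * \<phi> n (osc_walk \<xi> \<xi>' 0 (Suc m) \<omega>)"
        by (cases "osc_walk \<xi> \<xi>' 0 (Suc m) \<omega> = 0") (simp_all add: indicator_def del: osc_walk.simps)
    qed
    also have "\<dots> = (\<integral>\<^sup>+\<omega>. indicator (N m) \<omega>
        * (\<integral>\<^sup>+z. \<phi> n z \<partial>measure_pmf (osc_step \<mu> \<mu>' (osc_walk \<xi> \<xi>' 0 m \<omega>))) \<partial>M)"
      unfolding N_def by (rule osc_walk_markov[OF ds])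
    finally show ?thesis unfolding E .
  qed
  \<comment> \<open>On \<open>N (Suc m)\<close> the walk is away from \<open>0\<close> at time
    \<open>Suc m\<close>, so the recursive case of \<open>hit_prob\<close> applies there. The trade
    stops at time \<open>1\<close>, since at time \<open>0\<close> the walk sits at
    \<open>0\<close>, where \<open>hit_prob\<close> is \<open>1\<close> by convention.\<close>
  have Z_shift: "Z (Suc (Suc m)) (\<phi> n) = Z (Suc m) (\<phi> (Suc n))" for m n
    unfolding Z_Suc[of "Suc m"] Z_def[of "Suc m"]
    by (intro nn_integral_cong) (auto simp: \<phi>_def N_def indicator_def simp del: osc_walk.simps)
  have Z_eq: "Z (Suc m) (\<phi> n) = Z (Suc 0) (\<phi> (n + m))" for m n
    by (induction m arbitrary: n) (simp_all add: Z_shift)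
  have "emeasure M {\<omega> \<in> space M. \<forall>k\<in>{1..Suc r}. osc_walk \<xi> \<xi>' 0 k \<omega> \<noteq> 0}
      = (\<integral>\<^sup>+\<omega>. indicator {\<omega> \<in> space M. \<forall>k\<in>{1..Suc r}. osc_walk \<xi> \<xi>' 0 k \<omega> \<noteq> 0} \<omega> \<partial>M)"
    by (rule nn_integral_indicator[symmetric]) measurable
  also have "\<dots> = Z (Suc r) (\<phi> 0)"
    unfolding Z_def
    by (intro nn_integral_cong) (auto simp: \<phi>_def N_def indicator_def simp del: osc_walk.simps)
  also have "\<dots> = Z (Suc 0) (\<phi> r)" using Z_eq[of r 0] by simp
  also have "\<dots> = ennreal (1 - measure_pmf.expectation (osc_step \<mu> \<mu>' 0) (hit_prob \<mu> \<mu>' r))"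
    unfolding Z_Suc by (simp add: N_def emeasure_space_1)
  finally show ?thesis .
qed

lemma recurrent_state_0:
  assumes ds: "driving_sequence M \<mu> \<mu>' \<xi> \<xi>'"
    and lim: "(\<lambda>n. measure_pmf.expectation (osc_step \<mu> \<mu>' 0) (hit_prob \<mu> \<mu>' n)) \<longlonglongrightarrow> 1"
  shows "recurrent_state M \<xi> \<xi>' 0"
proof -
  interpret prob_space M by (rule driving_sequenceD(1)[OF ds])
  note [measurable] = walk_measurable[OF ds]
  let ?B = "{\<omega> \<in> space M. \<forall>k\<ge>1. osc_walk \<xi> \<xi>' 0 k \<omega> \<noteq> 0}"
  have B: "?B \<in> sets M" by measurable
  have "emeasure M ?B \<le> ennreal (1 - measure_pmf.expectation (osc_step \<mu> \<mu>' 0) (hit_prob \<mu> \<mu>' r))" for r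
    unfolding no_return_prob[OF ds, symmetric] by (rule emeasure_mono) (auto, measurable)
  moreover have "(\<lambda>r. ennreal (1 - measure_pmf.expectation (osc_step \<mu> \<mu>' 0) (hit_prob \<mu> \<mu>' r))) \<longlonglongrightarrow> ennreal (1 - 1)"
    by (intro tendsto_ennrealI tendsto_diff tendsto_const lim)
  ultimately have "emeasure M ?B \<le> ennreal (1 - 1)"
    by (intro LIMSEQ_le_const) auto
  then have "emeasure M ?B = 0" by simp
  then show ?thesis
    unfolding recurrent_state_def using B by (auto intro!: AE_I[of _ _ ?B])
qed

lemma nn_expectation_driving:
  assumes "distr M (count_space UNIV) Z = measure_pmf \<mu>" and "Z \<in> measurable M (count_space UNIV)"
  shows "nn_expectation M (neg_part Z) = (\<integral>\<^sup>+s. ennreal (max (- real_of_int s) 0) \<partial>measure_pmf \<mu>)"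
    and "nn_expectation M (pos_part Z) = (\<integral>\<^sup>+s. ennreal (max (real_of_int s) 0) \<partial>measure_pmf \<mu>)"
    and "nn_expectation M (\<lambda>\<omega>. neg_part Z \<omega> powr r) = (\<integral>\<^sup>+s. ennreal (max (- real_of_int s) 0 powr r) \<partial>measure_pmf \<mu>)"
    and "nn_expectation M (\<lambda>\<omega>. pos_part Z \<omega> powr r) = (\<integral>\<^sup>+s. ennreal (max (real_of_int s) 0 powr r) \<partial>measure_pmf \<mu>)"
proof -
  have "(\<integral>\<^sup>+\<omega>. \<phi> (Z \<omega>) \<partial>M) = (\<integral>\<^sup>+s. \<phi> s \<partial>measure_pmf \<mu>)" for \<phi> :: "int \<Rightarrow> ennreal"
    unfolding assms(1)[symmetric] using assms(2) by (intro nn_integral_distr[symmetric]) auto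
  then show "nn_expectation M (neg_part Z) = (\<integral>\<^sup>+s. ennreal (max (- real_of_int s) 0) \<partial>measure_pmf \<mu>)"
    and "nn_expectation M (pos_part Z) = (\<integral>\<^sup>+s. ennreal (max (real_of_int s) 0) \<partial>measure_pmf \<mu>)"
    and "nn_expectation M (\<lambda>\<omega>. neg_part Z \<omega> powr r) = (\<integral>\<^sup>+s. ennreal (max (- real_of_int s) 0 powr r) \<partial>measure_pmf \<mu>)"
    and "nn_expectation M (\<lambda>\<omega>. pos_part Z \<omega> powr r) = (\<integral>\<^sup>+s. ennreal (max (real_of_int s) 0 powr r) \<partial>measure_pmf \<mu>)"
    by (simp_all add: nn_expectation_def neg_part_def[abs_def] pos_part_def[abs_def])
qed

theorem theorem4p8:
  fixes M :: "'a measure"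
    and \<mu> \<mu>' :: "int pmf"
    and \<xi> \<xi>' :: "nat \<Rightarrow> 'a \<Rightarrow> int"
    and p q :: real
  assumes "driving_sequence M \<mu> \<mu>' \<xi> \<xi>'"
    and "Gcd (set_pmf \<mu>) = 1"
    and "Gcd (set_pmf \<mu>') = 1"
    and "0 < p" and "p < 1" and "0 < q" and "q < 1" and "p + q = 1"
    and "
      (nn_expectation M (neg_part (\<xi> 1)) < nn_expectation M (pos_part (\<xi> 1)) \<and>
       nn_expectation M (\<lambda>\<omega>. pos_part (\<xi> 1) \<omega> powr p) < \<infinity> \<and>
       nn_expectation M (pos_part (\<xi>' 1)) < nn_expectation M (neg_part (\<xi>' 1)) \<and>
       nn_expectation M (\<lambda>\<omega>. neg_part (\<xi>' 1) \<omega> powr q) < \<infinity>) \<or>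
      (nn_expectation M (neg_part (\<xi> 1)) = nn_expectation M (pos_part (\<xi> 1)) \<and>
       nn_expectation M (\<lambda>\<omega>. pos_part (\<xi> 1) \<omega> powr (1 + p)) < \<infinity> \<and>
       nn_expectation M (pos_part (\<xi>' 1)) = nn_expectation M (neg_part (\<xi>' 1)) \<and>
       nn_expectation M (\<lambda>\<omega>. neg_part (\<xi>' 1) \<omega> powr (1 + q)) < \<infinity>) \<or>
      (nn_expectation M (neg_part (\<xi> 1)) < nn_expectation M (pos_part (\<xi> 1)) \<and>
       nn_expectation M (\<lambda>\<omega>. pos_part (\<xi> 1) \<omega> powr p) < \<infinity> \<and>
       nn_expectation M (pos_part (\<xi>' 1)) = nn_expectation M (neg_part (\<xi>' 1)) \<and>
       nn_expectation M (\<lambda>\<omega>. neg_part (\<xi>' 1) \<omega> powr (1 + q)) < \<infinity>) \<or>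
      (nn_expectation M (neg_part (\<xi> 1)) = nn_expectation M (pos_part (\<xi> 1)) \<and>
       nn_expectation M (\<lambda>\<omega>. pos_part (\<xi> 1) \<omega> powr (1 + p)) < \<infinity> \<and>
       nn_expectation M (pos_part (\<xi>' 1)) < nn_expectation M (neg_part (\<xi>' 1)) \<and>
       nn_expectation M (\<lambda>\<omega>. neg_part (\<xi>' 1) \<omega> powr q) < \<infinity>)"
  shows "recurrent_on_essential_class M \<xi> \<xi>'"
proof -
  note ds = assms(1)
  note \<xi> = nn_expectation_driving[OF driving_sequenceD(3)[OF ds order_refl] driving_sequenceD(5)[OF ds order_refl]]
  note \<xi>' = nn_expectation_driving[OF driving_sequenceD(4)[OF ds order_refl] driving_sequenceD(6)[OF ds order_refl]]
  have "upward p \<mu> \<and> upward q (map_pmf uminus \<mu>')"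
    using assms(9) unfolding \<xi> \<xi>' by (auto simp: upward_def)
  then have up: "upward p \<mu>" and up': "upward q (map_pmf uminus \<mu>')" by auto
  have gcd': "Gcd (set_pmf (map_pmf uminus \<mu>')) = 1" using assms(3) by (simp add: Gcd_uminus_image)
  obtain b where b: "b \<in> set_pmf \<mu>" "0 < b" by (rule upward_positive_step[OF up assms(2)])
  obtain d where "d \<in> set_pmf (map_pmf uminus \<mu>')" and d: "0 < d" by (rule upward_positive_step[OF up' gcd'])
  then have d': "- d \<in> set_pmf \<mu>'" by auto
  have to_0: "accessible M \<xi> \<xi>' x 0" for x
    unfolding accessible_iff[OF ds] by (rule osc_step_reaches_0[OF assms(2) b d' d])
  have trans: "accessible M \<xi> \<xi>' x z" if "accessible M \<xi> \<xi>' x y" "accessible M \<xi> \<xi>' y z" for x y z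
    using that unfolding accessible_iff[OF ds] by (rule rtranclp_trans)
  \<comment> \<open>Since \<open>0\<close> is accessible from every state, its forward orbit is
    closed and communicating, and any essential class contains \<open>0\<close> and equals this
    orbit.\<close>
  define C where "C = {y. accessible M \<xi> \<xi>' 0 y}"
  have C: "essential_class M \<xi> \<xi>' C"
    using to_0 trans unfolding essential_class_def C_def by blast
  have unique: "D = C" if "essential_class M \<xi> \<xi>' D" for D
    using that to_0 trans unfolding essential_class_def C_def by blast
  have "recurrent_state M \<xi> \<xi>' 0"
    by (rule recurrent_state_0[OF ds return_prob_tendsto_1[OF up up' assms(2,3,4,6,8)]])
  then show ?thesis
    using C unique to_0 unfolding recurrent_on_essential_class_def C_def by blast
qed

end
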